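(* Let $X$ be a closure space, let $A\subset X$ be non-empty and closed, and suppose $(X,A)$ is a good pair. Then there is an exact sequence \[\cdots \to \tilde{H}_n(A)\xrightarrow{i_*} \tilde{H}_n(X)\xrightarrow{q_*} \tilde{H}_n(X/A)\xrightarrow{\partial} \tilde{H}_{n-1}(A)\xrightarrow{i_*} \tilde{H}_{n-1}(X)\to\cdots\] where $i:A\to X$ is the inclusion and $q:X\to X/A$ is the quotient map.
   Context: A (Čech) closure space is a pair $(X,c)$ of a set $X$ and a function $c:2^X\to 2^X$ with $c(\varnothing)=\varnothing$, $A\subset c(A)$, and $c(A\cup B)=c(A)\cup c(B)$ for all $A,B\subset X$. Topological spaces are the closure spaces with $c(c(A))=c(A)$ for all $A$, where $c$ is the topological closure. $A\subset X$ is closed if $c(A)=A$. A map $f:(X,c)\to(Y,d)$ is continuous if $f(c(A))\subset d(f(A))$ for all $A\subset X$. A subset $A\subset X$ carries the subspace closure $c_A(B)=A\cap c(B)$ for $B\subset A$. The interior operator is $X\setminus c(X\setminus A)$ for $A\subset X$; a set $B\supset A$ is a neighborhood of $A$ if $A$ is contained in the interior of $B$. The product $X\times Y$ has the closure in which $(x,y)$ is in the closure of $S$ iff $U\times V$ meets $S$ for all neighborhoods $U$ of $x$ and $V$ of $y$. The quotient $X/A$ (collapsing $A$ to a point) with quotient map $q$ has closure $c_q(S)=q(c(q^{-1}(S)))$. $I=[0,1]$ has the standard topology; a homotopy between continuous $f,g:X\to Y$ is a continuous $H:X\times I\to Y$ with $H(x,0)=f(x)$, $H(x,1)=g(x)$.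 A retraction of $X$ onto $A$ is a continuous $r:X\to X$ with $r(X)=A$ and $r|_A=\mathrm{id}_A$; a deformation retraction is a retraction $r$ together with a homotopy between $\mathrm{id}_X$ and $r$, and then $X$ is said to deformation retract onto $A$. $(X,A)$ is a good pair if there is a neighborhood $B$ of $A$ in $X$ that (with its subspace closure) deformation retracts onto $A$. Singular homology: let $|\Delta^n|=\{(t_0,\dots,t_n)\in\mathbb{R}^{n+1} : \sum_i t_i=1,\ t_i\ge 0\}=[e_0,\dots,e_n]$ with the Euclidean topology. $C_n(X)$ is the free abelian group on continuous maps $\sigma:|\Delta^n|\to X$, with $\partial_n(\sigma)=\sum_{i=0}^n(-1)^i\sigma|_{[e_0,\dots,\hat e_i,\dots,e_n]}$. The reduced homology $\tilde H_n(X)$ of a nonempty $X$ is the homology of the augmented complex $\cdots\to C_1(X)\to C_0(X)\xrightarrow{\epsilon}\mathbb{Z}\to 0$, $\epsilon(\sum_i n_i\sigma_i)=\sum_i n_i$.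
   Formalization: In a good pair, the homotopy of the deformation retraction of B onto A is also required to keep A inside A at all times (implied by a homotopy relative to A); with an arbitrary homotopy the claim fails, e.g. for two cones over Hawaiian earrings joined by an arc A. *)

theory Defs
  imports "HOL-Homology.Homology"
begin

subsection \<open>Cech closure spaces\<close>

text \<open>Only the values of \<^term>\<open>cl\<close> on subsets of \<^term>\<open>points\<close> are meaningful.\<close>

record 'a closure_space =
  points :: "'a set"
  cl :: "'a set \<Rightarrow> 'a set"

definition closure_space :: "'a closure_space \<Rightarrow> bool" where
  "closure_space X \<longleftrightarrow>
     cl X {} = {} \<and>
     (\<forall>A\<subseteq>points X. A \<subseteq> cl X A \<and> cl X A \<subseteq> points X) \<and>
     (\<forall>A\<subseteq>points X. \<forall>B\<subseteq>points X. cl X (A \<union> B) = cl X A \<union> cl X B)"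

definition cs_of_topology :: "'a topology \<Rightarrow> 'a closure_space" where
  "cs_of_topology T = \<lparr>points = topspace T, cl = (\<lambda>A. T closure_of A)\<rparr>"

definition cs_closed :: "'a closure_space \<Rightarrow> 'a set \<Rightarrow> bool" where
  "cs_closed X A \<longleftrightarrow> A \<subseteq> points X \<and> cl X A = A"

definition cs_continuous :: "'a closure_space \<Rightarrow> 'b closure_space \<Rightarrow> ('a \<Rightarrow> 'b) \<Rightarrow> bool" where
  "cs_continuous X Y f \<longleftrightarrow>
     f \<in> points X \<rightarrow> points Y \<and> (\<forall>A\<subseteq>points X. f ` cl X A \<subseteq> cl Y (f ` A))"

definition cs_subspace :: "'a closure_space \<Rightarrow> 'a set \<Rightarrow> 'a closure_space" where
  "cs_subspace X A = \<lparr>points = A, cl = (\<lambda>B. A \<inter> cl X B)\<rparr>"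

definition cs_interior :: "'a closure_space \<Rightarrow> 'a set \<Rightarrow> 'a set" where
  "cs_interior X A = points X - cl X (points X - A)"

definition cs_nbhd :: "'a closure_space \<Rightarrow> 'a set \<Rightarrow> 'a set \<Rightarrow> bool" where
  "cs_nbhd X A B \<longleftrightarrow> A \<subseteq> B \<and> B \<subseteq> points X \<and> A \<subseteq> cs_interior X B"

definition cs_prod :: "'a closure_space \<Rightarrow> 'b closure_space \<Rightarrow> ('a \<times> 'b) closure_space" where
  "cs_prod X Y =
     \<lparr>points = points X \<times> points Y,
      cl = (\<lambda>S. {(x, y) \<in> points X \<times> points Y.
                  \<forall>U V. cs_nbhd X {x} U \<longrightarrow> cs_nbhd Y {y} V \<longrightarrow> (U \<times> V) \<inter> S \<noteq> {}})\<rparr>"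

text \<open>The points of the quotient are the equivalence classes: \<^term>\<open>A\<close> and the
  singletons outside \<^term>\<open>A\<close>.\<close>

definition collapse :: "'a set \<Rightarrow> 'a \<Rightarrow> 'a set" where
  "collapse A x = (if x \<in> A then A else {x})"

definition cs_quotient :: "'a closure_space \<Rightarrow> 'a set \<Rightarrow> 'a set closure_space" where
  "cs_quotient X A =
     \<lparr>points = collapse A ` points X,
      cl = (\<lambda>S. collapse A ` cl X {x \<in> points X. collapse A x \<in> S})\<rparr>"


subsection \<open>Homotopies, deformation retractions, good pairs\<close>

definition cs_homotopy ::
  "'a closure_space \<Rightarrow> 'b closure_space \<Rightarrow> ('a \<Rightarrow> 'b) \<Rightarrow> ('a \<Rightarrow> 'b) \<Rightarrow> ('a \<times> real \<Rightarrow> 'b) \<Rightarrow> bool" where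
  "cs_homotopy X Y f g H \<longleftrightarrow>
     cs_continuous (cs_prod X (cs_of_topology (top_of_set {0..1}))) Y H \<and>
     (\<forall>x\<in>points X. H (x, 0) = f x \<and> H (x, 1) = g x)"

definition cs_retraction :: "'a closure_space \<Rightarrow> 'a set \<Rightarrow> ('a \<Rightarrow> 'a) \<Rightarrow> bool" where
  "cs_retraction X A r \<longleftrightarrow>
     cs_continuous X X r \<and> r ` points X = A \<and> (\<forall>a\<in>A. r a = a)"

text \<open>
  The homotopy is one of maps of pairs, i.e. it keeps \<^term>\<open>A\<close> inside \<^term>\<open>A\<close>.  In particular
  every homotopy relative to \<^term>\<open>A\<close> (a deformation retraction in Hatcher's sense) qualifies.
  An arbitrary homotopy between the identity and a retraction does not suffice for the exact
  sequence of a good pair: let \<open>X\<close> be two cones over the Hawaiian earring whose bad base points are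
  joined by an arc \<open>A\<close>.  Then \<open>X\<close> and \<open>A\<close> are contractible and \<open>A\<close> is a retract of \<open>X\<close>, so the
  retraction is homotopic to the identity, but \<open>X/A\<close> is Griffiths' space, whose first homology
  group is nonzero.
\<close>

definition cs_deformation_retraction ::
  "'a closure_space \<Rightarrow> 'a set \<Rightarrow> ('a \<Rightarrow> 'a) \<Rightarrow> ('a \<times> real \<Rightarrow> 'a) \<Rightarrow> bool" where
  "cs_deformation_retraction X A r H \<longleftrightarrow>
     cs_retraction X A r \<and> cs_homotopy X X id r H \<and> (\<forall>a\<in>A. \<forall>t\<in>{0..1}. H (a, t) \<in> A)"

definition cs_good_pair :: "'a closure_space \<Rightarrow> 'a set \<Rightarrow> bool" where
  "cs_good_pair X A \<longleftrightarrow>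
     (\<exists>B. cs_nbhd X A B \<and> (\<exists>r H. cs_deformation_retraction (cs_subspace X B) A r H))"


subsection \<open>Reduced singular homology\<close>

text \<open>As for topological spaces in HOL-Homology, simplices are made extensional outside
  \<^term>\<open>standard_simplex p\<close>, so that each map is represented by exactly one function.\<close>

definition cs_simplex :: "nat \<Rightarrow> 'a closure_space \<Rightarrow> ((nat \<Rightarrow> real) \<Rightarrow> 'a) \<Rightarrow> bool" where
  "cs_simplex p X \<sigma> \<longleftrightarrow>
     cs_continuous (cs_of_topology (subtopology (powertop_real UNIV) (standard_simplex p))) X \<sigma> \<and>
     \<sigma> \<in> extensional (standard_simplex p)"

text \<open>
  The augmented complex, indexed by all integers.  So that all degrees live in the type
  \<^typ>\<open>'a chain\<close>, the group of integers in degree \<open>-1\<close> is realised as the free abelian group on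
  one generator, the map \<open>\<lambda>_. undefined\<close> (the only extensional map on the empty simplex); the integer
  \<open>k\<close> is \<open>frag_cmul k (frag_of empty_simplex)\<close>.  The groups below degree \<open>-1\<close> are zero.
\<close>

definition empty_simplex :: "(nat \<Rightarrow> real) \<Rightarrow> 'a" where
  "empty_simplex = (\<lambda>_. undefined)"

definition aug_chain_group :: "int \<Rightarrow> 'a closure_space \<Rightarrow> 'a chain monoid" where
  "aug_chain_group n X = free_Abelian_group
     (if n \<ge> 0 then {\<sigma>. cs_simplex (nat n) X \<sigma>} else if n = -1 then {empty_simplex} else {})"

definition augmentation :: "'a chain \<Rightarrow> int" where
  "augmentation c = (\<Sum>\<sigma>\<in>Poly_Mapping.keys c. Poly_Mapping.lookup c \<sigma>)"

definition aug_boundary :: "int \<Rightarrow> 'a chain \<Rightarrow> 'a chain" where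
  "aug_boundary n c =
     (if n \<ge> 1 then chain_boundary (nat n) c
      else if n = 0 then frag_cmul (augmentation c) (frag_of empty_simplex)
      else 0)"

definition aug_cycle_group :: "int \<Rightarrow> 'a closure_space \<Rightarrow> 'a chain monoid" where
  "aug_cycle_group n X = subgroup_generated (aug_chain_group n X)
     (kernel (aug_chain_group n X) (aug_chain_group (n - 1) X) (aug_boundary n))"

definition aug_boundaries :: "int \<Rightarrow> 'a closure_space \<Rightarrow> 'a chain set" where
  "aug_boundaries n X = aug_boundary (n + 1) ` carrier (aug_chain_group (n + 1) X)"

definition cs_reduced_homology :: "int \<Rightarrow> 'a closure_space \<Rightarrow> 'a chain set monoid" where
  "cs_reduced_homology n X = aug_cycle_group n X Mod aug_boundaries n X"

definition aug_chain_map :: "int \<Rightarrow> ('a \<Rightarrow> 'b) \<Rightarrow> 'a chain \<Rightarrow> 'b chain" where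
  "aug_chain_map n f c =
     (if n \<ge> 0 then chain_map (nat n) f c
      else frag_cmul (Poly_Mapping.lookup c empty_simplex) (frag_of empty_simplex))"

text \<open>The class \<open>[z]\<close> is sent to \<open>[f\<^sub># z]\<close>.  The cosets united below all coincide when \<^term>\<open>f\<close>
  is continuous.\<close>

definition cs_reduced_hom_induced ::
  "int \<Rightarrow> 'b closure_space \<Rightarrow> ('a \<Rightarrow> 'b) \<Rightarrow> 'a chain set \<Rightarrow> 'b chain set" where
  "cs_reduced_hom_induced n Y f K =
     (\<Union>z\<in>K. aug_boundaries n Y #>\<^bsub>aug_cycle_group n Y\<^esub> aug_chain_map n f z)"

definition exact_at ::
  "('a, 'm) monoid_scheme \<Rightarrow> ('a \<Rightarrow> 'b) \<Rightarrow> ('b, 'n) monoid_scheme \<Rightarrow> ('b \<Rightarrow> 'c) \<Rightarrow> ('c, 'k) monoid_scheme \<Rightarrow> bool"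
  where
  "exact_at F f G g H \<longleftrightarrow>
     group_hom F G f \<and> group_hom G H g \<and> f ` carrier F = kernel G H g"

end

theory Submission
  imports Defs
begin

text \<open>
  Write \<open>Y\<close> for \<open>X/A\<close>, let \<open>*\<close> be its point \<open>A\<close>, and let \<open>q\<close> be the collapse.  Everything rests on
  the fact that \<open>q\<close> identifies the homology of the pair \<open>(X, A)\<close> with that of \<open>(Y, *)\<close>.  As the
  augmented complex of a point is acyclic, the latter is the reduced homology of \<open>Y\<close>, and the
  required sequence is the long exact sequence of the pair \<open>(X, A)\<close>: the connecting homomorphism lifts
  a cycle of \<open>Y\<close> to a relative cycle of \<open>(X, A)\<close> and takes its boundary.

  The comparison of the two pairs is excision for the neighbourhood \<open>B\<close> that deforms onto \<open>A\<close>.  Since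
  \<open>A\<close> is closed, the interiors of \<open>B\<close> and \<open>X - A\<close> cover \<open>X\<close>, and their images do the same for \<open>Y\<close>.
  Every simplex is continuous on a compact topological space, so sufficiently fine barycentric
  subdivision makes chains small for these covers.  Off \<open>A\<close> the collapse is a homeomorphism, so that
  small simplices there can be moved between \<open>X\<close> and \<open>Y\<close>, and what is left lies in \<open>B\<close> or its image,
  where the deformation pushes relative cycles into \<open>A\<close> or \<open>*\<close>.  Surjectivity and injectivity of the
  comparison are the lemmas \<open>lift_relative_cycle\<close> and \<open>relative_boundary_if_quotient_boundary\<close>.

  Two points differ from the topological case.  The deformation of \<open>B\<close> has to descend to \<open>B/A\<close>
  although the product with the interval does not respect quotients of closure spaces; the tube lemma
  makes it continuous (\<open>cs_continuous_quotient_homotopy\<close>).  And the singular chains of a closure space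
  are not those of a topological space, so subdivision and homotopy operators must be natural: they are
  built once on standard simplices, which are topological, and transported along each simplex
  (\<open>prism_homotopy\<close>).
\<close>

section \<open>Closure spaces and continuous maps\<close>

lemma points_cs_of_topology [simp]: "points (cs_of_topology T) = topspace T"
  by (simp add: cs_of_topology_def)

lemma cl_cs_of_topology [simp]: "cl (cs_of_topology T) S = T closure_of S"
  by (simp add: cs_of_topology_def)

lemma points_cs_subspace [simp]: "points (cs_subspace X S) = S"
  by (simp add: cs_subspace_def)

lemma cl_cs_subspace [simp]: "cl (cs_subspace X S) B = S \<inter> cl X B"
  by (simp add: cs_subspace_def)

lemma points_cs_prod [simp]: "points (cs_prod X Y) = points X \<times> points Y"
  by (simp add: cs_prod_def)

lemma closure_space_cs_of_topology: "closure_space (cs_of_topology T)"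
  by (auto simp: closure_space_def closure_of_subset closure_of_subset_topspace subsetD)

lemma cl_empty: "closure_space X \<Longrightarrow> cl X {} = {}"
  by (simp add: closure_space_def)

lemma cl_increasing: "closure_space X \<Longrightarrow> S \<subseteq> points X \<Longrightarrow> S \<subseteq> cl X S"
  by (simp add: closure_space_def)

lemma cl_subset_points: "closure_space X \<Longrightarrow> S \<subseteq> points X \<Longrightarrow> cl X S \<subseteq> points X"
  by (simp add: closure_space_def)

lemma cl_Un:
  "closure_space X \<Longrightarrow> S \<subseteq> points X \<Longrightarrow> T \<subseteq> points X \<Longrightarrow> cl X (S \<union> T) = cl X S \<union> cl X T"
  by (simp add: closure_space_def)

lemma cl_mono:
  assumes "closure_space X" "S \<subseteq> T" "T \<subseteq> points X"
  shows "cl X S \<subseteq> cl X T"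
  using cl_Un[OF assms(1), of S T] assms by (metis Un_upper1 dual_order.trans subset_Un_eq)

lemma closure_space_subspace:
  assumes "closure_space X" "S \<subseteq> points X"
  shows "closure_space (cs_subspace X S)"
proof -
  have "B \<subseteq> points X" if "B \<subseteq> S" for B
    using that assms(2) by blast
  with assms(1) show ?thesis
    unfolding closure_space_def by (simp add: Int_Un_distrib)
qed

lemma cs_continuousI:
  assumes "\<And>x. x \<in> points X \<Longrightarrow> f x \<in> points Y"
    and "\<And>S x. S \<subseteq> points X \<Longrightarrow> x \<in> cl X S \<Longrightarrow> f x \<in> cl Y (f ` S)"
  shows "cs_continuous X Y f"
  using assms by (simp add: cs_continuous_def Pi_iff image_subset_iff)

lemma cs_continuous_points: "cs_continuous X Y f \<Longrightarrow> x \<in> points X \<Longrightarrow> f x \<in> points Y"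
  by (simp add: cs_continuous_def Pi_iff)

lemma cs_continuous_image: "cs_continuous X Y f \<Longrightarrow> S \<subseteq> points X \<Longrightarrow> f ` S \<subseteq> points Y"
  using cs_continuous_points[of X Y f] by blast

lemma cs_continuous_cl:
  "cs_continuous X Y f \<Longrightarrow> S \<subseteq> points X \<Longrightarrow> x \<in> cl X S \<Longrightarrow> f x \<in> cl Y (f ` S)"
  by (simp add: cs_continuous_def image_subset_iff)

lemma cs_continuous_compose:
  assumes f: "cs_continuous X Y f" and g: "cs_continuous Y Z g"
  shows "cs_continuous X Z (g \<circ> f)"
proof (rule cs_continuousI)
  show "(g \<circ> f) x \<in> points Z" if "x \<in> points X" for x
    using that f g by (simp add: cs_continuous_points)
  show "(g \<circ> f) x \<in> cl Z ((g \<circ> f) ` S)" if "S \<subseteq> points X" "x \<in> cl X S" for S x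
    using cs_continuous_cl[OF g cs_continuous_image[OF f that(1)] cs_continuous_cl[OF f that]]
    by (simp add: image_comp)
qed

lemma cs_continuous_cong_imp:
  assumes X: "closure_space X" and eq: "\<And>x. x \<in> points X \<Longrightarrow> f x = g x"
    and f: "cs_continuous X Y f"
  shows "cs_continuous X Y g"
proof (rule cs_continuousI)
  show "g x \<in> points Y" if "x \<in> points X" for x
    using cs_continuous_points[OF f that] eq[OF that] by simp
  show "g x \<in> cl Y (g ` S)" if S: "S \<subseteq> points X" and x: "x \<in> cl X S" for S x
  proof -
    have "f x = g x"
      using cl_subset_points[OF X S] x eq by blast
    moreover have "f ` S = g ` S"
      using S eq by (intro image_cong) auto
    ultimately show ?thesis
      using cs_continuous_cl[OF f S x] by simp
  qed
qed

lemma continuous_map_imp_cs_continuous: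
  assumes "continuous_map T U f"
  shows "cs_continuous (cs_of_topology T) (cs_of_topology U) f"
proof (rule cs_continuousI)
  show "f x \<in> points (cs_of_topology U)" if "x \<in> points (cs_of_topology T)" for x
    using assms that continuous_map_funspace[OF assms] by (simp add: Pi_iff)
  show "f x \<in> cl (cs_of_topology U) (f ` S)" if "x \<in> cl (cs_of_topology T) S" for S x
    using assms that by (simp add: continuous_map_eq_image_closure_subset Pi_iff)
qed

lemma cs_continuous_into_subspace:
  assumes T: "closure_space T" and S: "S \<subseteq> points X"
  shows "cs_continuous T (cs_subspace X S) f \<longleftrightarrow> cs_continuous T X f \<and> f \<in> points T \<rightarrow> S"
proof (intro iffI conjI)
  assume f: "cs_continuous T (cs_subspace X S) f"
  show "f \<in> points T \<rightarrow> S"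
    using cs_continuous_points[OF f] by simp
  show "cs_continuous T X f"
    using cs_continuous_points[OF f] cs_continuous_cl[OF f] S by (intro cs_continuousI) auto
next
  assume f: "cs_continuous T X f \<and> f \<in> points T \<rightarrow> S"
  then show "cs_continuous T (cs_subspace X S) f"
    using cs_continuous_cl[of T X f] cl_subset_points[OF T, THEN subsetD]
    by (intro cs_continuousI) (auto simp: Pi_iff)
qed

lemma cs_continuous_const:
  assumes X: "closure_space X" and Y: "closure_space Y" and a: "a \<in> points Y"
  shows "cs_continuous X Y (\<lambda>_. a)"
proof (rule cs_continuousI)
  show "a \<in> cl Y ((\<lambda>_. a) ` S)" if "x \<in> cl X S" for x S
  proof -
    have "S \<noteq> {}"
      using that cl_empty[OF X] by auto
    then show ?thesis
      using cl_increasing[OF Y, of "{a}"] a by (simp add: image_constant_conv)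
  qed
qed (use a in simp)

lemma cs_continuous_id: "cs_continuous X X (\<lambda>x. x)"
  by (rule cs_continuousI) auto

lemma cs_continuous_id_subspace: "S \<subseteq> points X \<Longrightarrow> cs_continuous (cs_subspace X S) X id"
  by (rule cs_continuousI) auto

lemma cs_continuous_restrict_subspaces:
  assumes f: "cs_continuous X Y f" and S: "S \<subseteq> points X" and T: "f ` S \<subseteq> T"
  shows "cs_continuous (cs_subspace X S) (cs_subspace Y T) f"
proof (rule cs_continuousI)
  show "f x \<in> points (cs_subspace Y T)" if "x \<in> points (cs_subspace X S)" for x
    using that T by auto
  show "f x \<in> cl (cs_subspace Y T) (f ` C)"
    if C: "C \<subseteq> points (cs_subspace X S)" and x: "x \<in> cl (cs_subspace X S) C" for C x
    using cs_continuous_cl[OF f, of C x] C x S T by auto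
qed

text \<open>The preimages of two neighbourhoods may be intersected because closure commutes with finite
  unions: a point in the closure of \<open>S\<close> stays in it after the part of \<open>S\<close> outside either preimage has
  been removed.\<close>

lemma cs_continuous_pair:
  assumes X: "closure_space X" and Y: "closure_space Y" and T: "closure_space T"
    and f: "cs_continuous T X f" and g: "cs_continuous T Y g"
  shows "cs_continuous T (cs_prod X Y) (\<lambda>t. (f t, g t))"
proof (rule cs_continuousI)
  show "(f t, g t) \<in> points (cs_prod X Y)" if "t \<in> points T" for t
    using that f g by (simp add: cs_continuous_points)
  show "(f t, g t) \<in> cl (cs_prod X Y) ((\<lambda>t. (f t, g t)) ` S)"
    if S: "S \<subseteq> points T" and t: "t \<in> cl T S" for S t
  proof -
    have tT: "t \<in> points T"
      using cl_subset_points[OF T S] t by blast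
    have "(U \<times> V) \<inter> (\<lambda>t. (f t, g t)) ` S \<noteq> {}"
      if U: "cs_nbhd X {f t} U" and V: "cs_nbhd Y {g t} V" for U V
    proof
      assume no: "(U \<times> V) \<inter> (\<lambda>t. (f t, g t)) ` S = {}"
      let ?P = "{s \<in> S. f s \<notin> U}" and ?Q = "{s \<in> S. g s \<notin> V}"
      have "S = ?P \<union> ?Q"
        using no by auto
      then have "cl T S = cl T ?P \<union> cl T ?Q"
        using cl_Un[OF T, of ?P ?Q] S by auto
      moreover have "t \<notin> cl T ?P"
      proof
        assume "t \<in> cl T ?P"
        then have "f t \<in> cl X (f ` ?P)"
          using cs_continuous_cl[OF f, of ?P t] S by auto
        moreover have "f ` ?P \<subseteq> points X - U"
          using S cs_continuous_points[OF f] by auto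
        ultimately show False
          using U cl_mono[OF X, of "f ` ?P" "points X - U"] by (auto simp: cs_nbhd_def cs_interior_def)
      qed
      moreover have "t \<notin> cl T ?Q"
      proof
        assume "t \<in> cl T ?Q"
        then have "g t \<in> cl Y (g ` ?Q)"
          using cs_continuous_cl[OF g, of ?Q t] S by auto
        moreover have "g ` ?Q \<subseteq> points Y - V"
          using S cs_continuous_points[OF g] by auto
        ultimately show False
          using V cl_mono[OF Y, of "g ` ?Q" "points Y - V"] by (auto simp: cs_nbhd_def cs_interior_def)
      qed
      ultimately show False
        using t by simp
    qed
    then show "(f t, g t) \<in> cl (cs_prod X Y) ((\<lambda>t. (f t, g t)) ` S)"
      using tT f g by (auto simp: cs_prod_def cs_continuous_points)
  qed
qed

section \<open>Singular chains of a closure space\<close>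

abbreviation simplex_top :: "nat \<Rightarrow> (nat \<Rightarrow> real) topology" where
  "simplex_top p \<equiv> subtopology (powertop_real UNIV) (standard_simplex p)"

lemma cs_simplex_simplex_map:
  assumes f: "cs_simplex p X f" and g: "cs_continuous X Y g"
  shows "cs_simplex p Y (simplex_map p g f)"
proof -
  have "cs_continuous (cs_of_topology (simplex_top p)) Y (g \<circ> f)"
    using assms cs_continuous_compose unfolding cs_simplex_def by blast
  then have "cs_continuous (cs_of_topology (simplex_top p)) Y (restrict (g \<circ> f) (standard_simplex p))"
    by (rule cs_continuous_cong_imp[OF closure_space_cs_of_topology, rotated]) auto
  then show ?thesis
    by (simp add: cs_simplex_def simplex_map_def)
qed

lemma cs_simplex_of_singular_simplex:
  "singular_simplex p T f \<Longrightarrow> cs_simplex p (cs_of_topology T) f"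
  by (simp add: singular_simplex_def cs_simplex_def continuous_map_imp_cs_continuous)

lemma cs_simplex_cong_subspace:
  assumes "S \<subseteq> points X"
  shows "cs_simplex p (cs_subspace X S) f \<longleftrightarrow> cs_simplex p X f \<and> f \<in> standard_simplex p \<rightarrow> S"
  using assms by (auto simp: cs_simplex_def cs_continuous_into_subspace[OF closure_space_cs_of_topology])

lemma cs_simplex_singular_face:
  assumes f: "cs_simplex p X f" and p: "1 \<le> p" and k: "k \<le> p"
  shows "cs_simplex (p - Suc 0) X (singular_face p k f)"
proof -
  let ?d = "singular_face p k (restrict id (standard_simplex p))"
  have "singular_simplex (p - Suc 0) (simplex_top p) ?d"
    using p k by (intro singular_simplex_singular_face) (auto simp: singular_simplex_def)
  then have "cs_simplex (p - Suc 0) X (simplex_map (p - Suc 0) f ?d)"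
    using f cs_simplex_simplex_map cs_simplex_of_singular_simplex unfolding cs_simplex_def by blast
  moreover have "simplex_map (p - Suc 0) f ?d = singular_face p k f"
    using p k
    by (auto simp: simplex_map_def singular_face_def simplical_face_in_standard_simplex fun_eq_iff)
  ultimately show ?thesis
    by simp
qed

definition cs_chain :: "nat \<Rightarrow> 'a closure_space \<Rightarrow> 'a chain \<Rightarrow> bool" where
  "cs_chain p X c \<longleftrightarrow> Poly_Mapping.keys c \<subseteq> {f. cs_simplex p X f}"

lemma cs_chain_0 [simp]: "cs_chain p X 0"
  by (simp add: cs_chain_def)

lemma cs_chain_of [simp]: "cs_chain p X (frag_of f) \<longleftrightarrow> cs_simplex p X f"
  by (simp add: cs_chain_def)

lemma cs_chain_cmul: "cs_chain p X c \<Longrightarrow> cs_chain p X (frag_cmul k c)"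
  using keys_cmul by (auto simp: cs_chain_def)

lemma cs_chain_minus: "cs_chain p X c \<Longrightarrow> cs_chain p X (- c)"
  by (simp add: cs_chain_def)

lemma cs_chain_add: "cs_chain p X c \<Longrightarrow> cs_chain p X d \<Longrightarrow> cs_chain p X (c + d)"
  using Poly_Mapping.keys_add[of c d] by (auto simp: cs_chain_def)

lemma cs_chain_diff: "cs_chain p X c \<Longrightarrow> cs_chain p X d \<Longrightarrow> cs_chain p X (c - d)"
  using keys_diff[of c d] by (auto simp: cs_chain_def)

lemma cs_chain_sum: "(\<And>i. i \<in> I \<Longrightarrow> cs_chain p X (f i)) \<Longrightarrow> cs_chain p X (sum f I)"
  by (induction I rule: infinite_finite_induct) (auto simp: cs_chain_add)

lemma cs_chain_extend:
  "(\<And>f. f \<in> Poly_Mapping.keys c \<Longrightarrow> cs_chain p X (g f)) \<Longrightarrow> cs_chain p X (frag_extend g c)"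
  by (auto simp: frag_extend_def intro!: cs_chain_sum cs_chain_cmul)

lemma cs_chain_boundary: "cs_chain p X c \<Longrightarrow> cs_chain (p - Suc 0) X (chain_boundary p c)"
  by (auto simp: chain_boundary_def cs_chain_def[of p X c] cs_simplex_singular_face
      intro!: cs_chain_extend cs_chain_sum cs_chain_cmul)

lemma cs_chain_boundary_Suc: "cs_chain (Suc p) X c \<Longrightarrow> cs_chain p X (chain_boundary (Suc p) c)"
  using cs_chain_boundary[of "Suc p"] by simp

lemma cs_chain_chain_map:
  "cs_chain p X c \<Longrightarrow> cs_continuous X Y g \<Longrightarrow> cs_chain p Y (chain_map p g c)"
  by (auto simp: chain_map_def cs_chain_def[of p X c] cs_simplex_simplex_map intro!: cs_chain_extend)

lemma cs_chain_of_singular_chain: "singular_chain p T c \<Longrightarrow> cs_chain p (cs_of_topology T) c"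
  by (auto simp: singular_chain_def cs_chain_def cs_simplex_of_singular_simplex)

lemma cs_chain_subspace:
  "S \<subseteq> points X \<Longrightarrow>
   cs_chain p (cs_subspace X S) c \<longleftrightarrow>
   cs_chain p X c \<and> (\<forall>f\<in>Poly_Mapping.keys c. f \<in> standard_simplex p \<rightarrow> S)"
  by (auto simp: cs_chain_def cs_simplex_cong_subspace)

lemma cs_chain_subspace_imp: "cs_chain p (cs_subspace X S) c \<Longrightarrow> S \<subseteq> points X \<Longrightarrow> cs_chain p X c"
  by (simp add: cs_chain_subspace)

lemma cs_chain_subspace_mono:
  "cs_chain p (cs_subspace X S) c \<Longrightarrow> S \<subseteq> T \<Longrightarrow> T \<subseteq> points X \<Longrightarrow> cs_chain p (cs_subspace X T) c"
  by (auto simp: cs_chain_subspace Pi_iff)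

lemma cs_chain_subspace_Int:
  "cs_chain p (cs_subspace X S) c \<Longrightarrow> cs_chain p (cs_subspace X T) c \<Longrightarrow>
   S \<subseteq> points X \<Longrightarrow> T \<subseteq> points X \<Longrightarrow> cs_chain p (cs_subspace X (S \<inter> T)) c"
  by (auto simp: cs_chain_subspace Pi_iff le_infI1)

text \<open>
  Every function into the indiscrete topology is continuous.  Hence the purely algebraic identities
  between face, boundary, subdivision and induced chain maps that hold for singular chains of a
  topological space hold for the singular chains of a closure space as well.
\<close>

abbreviation indiscrete :: "'a topology" where
  "indiscrete \<equiv> topology_generated_by {UNIV}"

lemma singular_simplex_indiscrete:
  "singular_simplex p indiscrete f \<longleftrightarrow> f \<in> extensional (standard_simplex p)"
  using openin_topspace[of "simplex_top p"]
  by (auto simp: singular_simplex_def intro!: continuous_on_generated_topo)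

lemma singular_chain_indiscrete: "cs_chain p X c \<Longrightarrow> singular_chain p indiscrete c"
  by (auto simp: cs_chain_def singular_chain_def singular_simplex_indiscrete cs_simplex_def)

lemma cs_chain_boundary_boundary:
  "cs_chain p X c \<Longrightarrow> chain_boundary (p - Suc 0) (chain_boundary p c) = 0"
  using chain_boundary_boundary singular_chain_indiscrete by blast

lemma cs_chain_boundary_chain_map:
  "cs_chain p X c \<Longrightarrow> chain_boundary p (chain_map p g c) = chain_map (p - Suc 0) g (chain_boundary p c)"
  using chain_boundary_chain_map singular_chain_indiscrete by blast

lemma cs_chain_map_cong:
  assumes "cs_chain p X c" "\<And>x. x \<in> points X \<Longrightarrow> f x = g x"
  shows "chain_map p f c = chain_map p g c"
  using assms(1) unfolding cs_chain_def
proof (induction rule: frag_induction)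
  case (one s)
  then have "s t \<in> points X" if "t \<in> standard_simplex p" for t
    using that one cs_continuous_points[of "cs_of_topology (simplex_top p)" X s t]
    by (simp add: cs_simplex_def)
  then show ?case
    using assms(2) by (auto simp: simplex_map_def intro!: restrict_ext arg_cong[where f = frag_of])
qed (auto simp: chain_map_diff)

lemma cs_chain_map_id:
  assumes "cs_chain p X c" "\<And>x. x \<in> points X \<Longrightarrow> f x = x"
  shows "chain_map p f c = c"
proof -
  have "chain_map p f c = chain_map p id c"
    using assms by (intro cs_chain_map_cong) auto
  then show ?thesis
    using chain_map_ident singular_chain_indiscrete[OF assms(1)] by metis
qed

section \<open>Acyclic models\<close>

text \<open>A cylinder over the standard simplex is a topological space, so its singular chains are the
  classical ones; it serves as the universal example for chains of \<open>X \<times> [0, 1]\<close>.\<close>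

abbreviation cylinder :: "nat \<Rightarrow> ((nat \<Rightarrow> real) \<times> real) topology" where
  "cylinder p \<equiv> prod_topology (simplex_top p) (top_of_set {0..1})"

abbreviation id_simplex :: "nat \<Rightarrow> (nat \<Rightarrow> real) chain" where
  "id_simplex p \<equiv> frag_of (restrict id (standard_simplex p))"

lemma singular_chain_id_simplex: "singular_chain p (simplex_top p) (id_simplex p)"
  by (simp add: singular_chain_of singular_simplex_def)

lemma contractible_simplex_top: "contractible_space (simplex_top p)"
proof -
  obtain e where e: "e \<in> standard_simplex p"
    using nonempty_standard_simplex by blast
  let ?H = "\<lambda>(u::real, x). \<lambda>i. (1 - u) * x i + u * e i"
  have "continuous_map (prod_topology (top_of_set {0..1}) (simplex_top p)) (powertop_real UNIV) ?H"
    unfolding continuous_map_componentwise_UNIV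
  proof
    fix i
    have 1: "continuous_map (prod_topology (top_of_set {0..1}) (simplex_top p)) euclideanreal fst"
      by (metis continuous_map_fst continuous_map_in_subtopology)
    have "continuous_map (simplex_top p) euclideanreal (\<lambda>x. x i)"
      using continuous_map_product_projection[of i UNIV "\<lambda>_. euclideanreal"]
      by (simp add: continuous_map_from_subtopology)
    then have 2: "continuous_map (prod_topology (top_of_set {0..1}) (simplex_top p)) euclideanreal (\<lambda>z. snd z i)"
      using continuous_map_compose[OF continuous_map_snd] by (fastforce simp: o_def)
    show "continuous_map (prod_topology (top_of_set {0..1}) (simplex_top p)) euclideanreal (\<lambda>x. ?H x i)"
      unfolding case_prod_unfold by (intro continuous_intros 1 2)
  qed
  then have "continuous_map (prod_topology (top_of_set {0..1}) (simplex_top p)) (simplex_top p) ?H"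
    using e by (auto simp: continuous_map_in_subtopology convex_standard_simplex)
  moreover have "?H (0, x) = id x" "?H (1, x) = e" for x
    by auto
  ultimately have "homotopic_with (\<lambda>x. True) (simplex_top p) (simplex_top p) id (\<lambda>x. e)"
    unfolding homotopic_with_def by blast
  then show ?thesis
    by (auto simp: contractible_space_def)
qed

lemma contractible_cylinder: "contractible_space (cylinder p)"
proof -
  have "contractible_space (top_of_set {0..1::real})"
    unfolding contractible_space_subtopology_euclideanreal is_interval_1 by auto
  then show ?thesis
    by (simp only: contractible_space_prod_topology contractible_simplex_top simp_thms)
qed

text \<open>The constant map collapses a 0-cycle of augmentation 0 and turns a cycle of positive dimension
  into a boundary; homotopy invariance does the rest.\<close>

lemma contractible_space_cycle_is_boundary:
  assumes X: "contractible_space X"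
    and c: "singular_chain p X c" "chain_boundary p c = 0"
    and 0: "\<And>a. p = 0 \<Longrightarrow> chain_map 0 (\<lambda>_. a) c = (0 :: 'a chain)"
  shows "\<exists>d. singular_chain (Suc p) X d \<and> chain_boundary (Suc p) d = (c :: 'a chain)"
proof -
  obtain a where a: "homotopic_with (\<lambda>x. True) X X id (\<lambda>x. a)"
    using X by (auto simp: contractible_space_def)
  have hom: "homotopic_with (\<lambda>h. h \<in> {} \<rightarrow> {}) X X id (\<lambda>x. a)"
    using a by simp
  have cyc: "singular_relcycle p X {} c"
    using c by (simp add: singular_cycle)
  have rel: "homologous_rel p X {} (chain_map p id c) (chain_map p (\<lambda>x. a) c)"
    using homotopic_imp_homologous_rel_chain_maps[OF hom cyc] .
  have "singular_relboundary p X {} (chain_map p (\<lambda>x. a) c)"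
  proof (cases "p = 0")
    case True
    then show ?thesis
      using 0 by simp
  next
    case False
    show ?thesis
    proof (cases "topspace X = {}")
      case True
      then show ?thesis
        using c by (simp add: singular_chain_empty)
    next
      case False
      then have aX: "a \<in> topspace X"
        using homotopic_with_imp_continuous_maps[OF a] by (simp add: continuous_map_const)
      have "singular_relcycle p (subtopology X {a}) {} (chain_map p (\<lambda>x. a) c)"
        by (rule singular_relcycle_chain_map[OF cyc]) (use aX in auto)
      moreover have "topspace (subtopology X {a}) = {a}"
        using aX by auto
      ultimately have "singular_relboundary p (subtopology X {a}) {} (chain_map p (\<lambda>x. a) c)"
        using singular_boundary_eq_cycle_singleton \<open>p \<noteq> 0\<close> by (metis One_nat_def Suc_leI gr0I)
      then show ?thesis
        using singular_boundary_mono[of "{a}" "topspace X" p X] aX by simp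
    qed
  qed
  then have "singular_relboundary p X {} (chain_map p id c)"
    using rel unfolding homologous_rel_def by (metis diff_add_cancel singular_relboundary_add)
  then show ?thesis
    using chain_map_ident[OF c(1)] by (simp add: singular_boundary)
qed

text \<open>
  The prism over the standard simplex, for the homotopy between the bottom inclusion and the top
  inclusion composed with \<open>n\<close> barycentric subdivisions.  Its boundary must be the subdivided top
  minus the bottom minus the prisms over the faces; this is a cycle in a contractible space, and any
  chain with this boundary will do.
\<close>

primrec prism_model :: "nat \<Rightarrow> nat \<Rightarrow> ((nat \<Rightarrow> real) \<times> real) chain" where
  "prism_model n 0 = (SOME d. singular_chain 1 (cylinder 0) d \<and>
     chain_boundary 1 d =
       chain_map 0 (\<lambda>x. (x, 1)) ((singular_subdivision 0 ^^ n) (id_simplex 0))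
       - chain_map 0 (\<lambda>x. (x, 0)) (id_simplex 0))"
| "prism_model n (Suc p) = (SOME d. singular_chain (Suc (Suc p)) (cylinder (Suc p)) d \<and>
     chain_boundary (Suc (Suc p)) d =
       chain_map (Suc p) (\<lambda>x. (x, 1)) ((singular_subdivision (Suc p) ^^ n) (id_simplex (Suc p)))
       - chain_map (Suc p) (\<lambda>x. (x, 0)) (id_simplex (Suc p))
       - frag_extend (\<lambda>f. chain_map (Suc p) (map_prod f id) (prism_model n p))
           (chain_boundary (Suc p) (id_simplex (Suc p))))"

text \<open>Every simplex is the image of the identity simplex under itself, which dictates the values of a
  natural operator.\<close>

definition prism :: "nat \<Rightarrow> nat \<Rightarrow> 'a chain \<Rightarrow> ('a \<times> real) chain" where
  "prism n p = frag_extend (\<lambda>f. chain_map (Suc p) (map_prod f id) (prism_model n p))"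

lemma prism_0 [simp]: "prism n p 0 = 0"
  by (simp add: prism_def)

lemma prism_diff: "prism n p (c - d) = prism n p c - prism n p d"
  by (simp add: prism_def frag_extend_diff)

text \<open>In dimension 0 the boundary of the identity simplex vanishes, so that one equation covers
  both clauses of \<open>prism_model\<close>.\<close>

definition solves_prism_equation :: "nat \<Rightarrow> nat \<Rightarrow> bool" where
  "solves_prism_equation n p \<longleftrightarrow>
     singular_chain (Suc p) (cylinder p) (prism_model n p) \<and>
     chain_boundary (Suc p) (prism_model n p) =
       chain_map p (\<lambda>x. (x, 1)) ((singular_subdivision p ^^ n) (id_simplex p))
       - chain_map p (\<lambda>x. (x, 0)) (id_simplex p)
       - prism n (p - Suc 0) (chain_boundary p (id_simplex p))"

lemma naturality_iterated_subdivision: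
  "singular_chain p X c \<Longrightarrow>
   (singular_subdivision p ^^ n) (chain_map p g c) = chain_map p g ((singular_subdivision p ^^ n) c)"
proof (induction n)
  case (Suc n)
  have "singular_chain p X ((singular_subdivision p ^^ n) c)"
    using Suc.prems by (induction n) (auto intro: singular_chain_singular_subdivision)
  then show ?case
    using Suc by (simp add: naturality_singular_subdivision)
qed auto

lemma singular_chain_iterated_subdivision:
  "singular_chain p X c \<Longrightarrow> singular_chain p X ((singular_subdivision p ^^ n) c)"
  by (induction n) (auto intro: singular_chain_singular_subdivision)

lemma chain_boundary_iterated_subdivision:
  "singular_chain p X c \<Longrightarrow>
   chain_boundary p ((singular_subdivision p ^^ n) c)
     = (singular_subdivision (p - Suc 0) ^^ n) (chain_boundary p c)"
proof (induction n)
  case (Suc n)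
  then show ?case
    using chain_boundary_singular_subdivision[OF singular_chain_iterated_subdivision[OF Suc.prems, of n]]
    by simp
qed auto

text \<open>The maps \<open>map_prod (simplex_map p g f) id\<close> and \<open>map_prod g id \<circ> map_prod f id\<close> differ only
  off the standard simplex, where the cylinder has no points.\<close>

lemma naturality_prism:
  assumes "singular_chain (Suc p) (cylinder p) (prism_model n p)"
  shows "chain_map (Suc p) (map_prod g id) (prism n p c) = prism n p (chain_map p g c)"
proof -
  have eq: "chain_map (Suc p) (map_prod g id) (chain_map (Suc p) (map_prod f id) (prism_model n p))
      = chain_map (Suc p) (map_prod (simplex_map p g f) id) (prism_model n p)" for f
  proof -
    have "chain_map (Suc p) (map_prod g id \<circ> map_prod f id) (prism_model n p)
        = chain_map (Suc p) (map_prod (simplex_map p g f) id) (prism_model n p)"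
      by (rule chain_map_eq[OF assms]) (auto simp: simplex_map_def)
    then show ?thesis
      by (simp only: chain_map_compose comp_apply)
  qed
  show ?thesis
    using subset_UNIV
  proof (induction c rule: frag_induction)
    case (one f)
    show ?case
      by (simp only: prism_def frag_extend_of chain_map_of eq)
  qed (auto simp: prism_diff chain_map_diff)
qed

text \<open>Transport along a simplex turns the equation for the model into the homotopy formula.  The
  formula in one dimension makes the boundary of the next model equation vanish, so it is needed
  inside the induction that constructs the models.\<close>

lemma chain_boundary_prism_step:
  assumes p: "solves_prism_equation n p"
    and q: "p > 0 \<Longrightarrow> solves_prism_equation n (p - Suc 0)"
    and c: "singular_chain p X c"
  shows "chain_boundary (Suc p) (prism n p c) =
    chain_map p (\<lambda>x. (x, 1)) ((singular_subdivision p ^^ n) c) - chain_map p (\<lambda>x. (x, 0)) c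
    - prism n (p - Suc 0) (chain_boundary p c)"
  using c unfolding singular_chain_def
proof (induction c rule: frag_induction)
  case (one f)
  then have f: "chain_map p f (id_simplex p) = frag_of f"
    using singular_simplex_chain_map_id by auto
  have top: "chain_map p (map_prod f id) (chain_map p (\<lambda>x. (x, t)) c) = chain_map p (\<lambda>x. (x, t)) (chain_map p f c)"
    for t :: real and c
  proof -
    have "map_prod f id \<circ> (\<lambda>x. (x, t)) = (\<lambda>x. (x, t)) \<circ> f"
      by auto
    then show ?thesis
      by (metis chain_map_compose comp_apply)
  qed
  have side: "chain_map p (map_prod f id) (prism n (p - Suc 0) (chain_boundary p (id_simplex p)))
      = prism n (p - Suc 0) (chain_boundary p (frag_of f))"
  proof (cases "p = 0")
    case False
    then have "singular_chain (Suc (p - Suc 0)) (cylinder (p - Suc 0)) (prism_model n (p - Suc 0))"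
      using q by (simp add: solves_prism_equation_def)
    from naturality_prism[OF this, of f "chain_boundary p (id_simplex p)"] show ?thesis
      using False f chain_boundary_chain_map[OF singular_chain_id_simplex, of p f] by simp
  qed (simp add: chain_boundary_def)
  have "chain_boundary (Suc p) (prism n p (frag_of f))
      = chain_map p (map_prod f id) (chain_boundary (Suc p) (prism_model n p))"
    using chain_boundary_chain_map[of "Suc p" "cylinder p" "prism_model n p" "map_prod f id"] p
    by (simp add: prism_def solves_prism_equation_def)
  also have "\<dots> = chain_map p (\<lambda>x. (x, 1)) (chain_map p f ((singular_subdivision p ^^ n) (id_simplex p)))
      - chain_map p (\<lambda>x. (x, 0)) (frag_of f) - prism n (p - Suc 0) (chain_boundary p (frag_of f))"
    using p by (simp add: solves_prism_equation_def chain_map_diff top side f del: chain_map_of)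
  also have "chain_map p f ((singular_subdivision p ^^ n) (id_simplex p)) = (singular_subdivision p ^^ n) (frag_of f)"
    using naturality_iterated_subdivision[OF singular_chain_id_simplex] f by metis
  finally show ?case .
next
  case (diff a b)
  then show ?case
    by (simp add: prism_diff chain_boundary_diff chain_map_diff singular_subdivision_power_diff)
qed auto

lemma prism_model_solves: "solves_prism_equation n p"
proof (induction p rule: less_induct)
  case (less p)
  let ?i = "id_simplex p" and ?Sd = "\<lambda>p. singular_subdivision p ^^ n"
  let ?top = "\<lambda>p c. chain_map p (\<lambda>x. (x, 1::real)) (?Sd p c)"
  let ?bot = "\<lambda>p. chain_map p (\<lambda>x. (x, 0::real))"
  let ?rhs = "?top p ?i - ?bot p ?i - prism n (p - Suc 0) (chain_boundary p ?i)"
  have cont: "continuous_map (simplex_top p) (cylinder p) (\<lambda>x. (x, t))" if "t \<in> {0..1}" for t :: real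
    using that by (simp add: continuous_map_pairwise o_def continuous_map_const)
  have i: "singular_chain p (simplex_top p) ?i"
    by (rule singular_chain_id_simplex)
  have di: "singular_chain (p - Suc 0) (simplex_top p) (chain_boundary p ?i)"
    using singular_chain_boundary[OF i] .
  have "singular_chain p (cylinder p) (prism n (p - Suc 0) (chain_boundary p ?i))"
  proof (cases "p = 0")
    case False
    then have m: "singular_chain p (cylinder (p - Suc 0)) (prism_model n (p - Suc 0))"
      using less[of "p - Suc 0"] by (simp add: solves_prism_equation_def)
    show ?thesis
      unfolding prism_def
    proof (rule singular_chain_extend)
      fix f assume "f \<in> Poly_Mapping.keys (chain_boundary p ?i)"
      then have "continuous_map (simplex_top (p - Suc 0)) (simplex_top p) f"
        using di by (auto simp: singular_chain_def singular_simplex_def)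
      then have "continuous_map (cylinder (p - Suc 0)) (simplex_top p) (f \<circ> fst)"
        by (rule continuous_map_compose[OF continuous_map_fst])
      then have "continuous_map (cylinder (p - Suc 0)) (cylinder p) (map_prod f id)"
        using continuous_map_snd by (simp add: map_prod_def case_prod_unfold continuous_map_paired o_def)
      then show "singular_chain p (cylinder p)
         (chain_map (Suc (p - Suc 0)) (map_prod f id) (prism_model n (p - Suc 0)))"
        using m False by (simp add: singular_chain_chain_map)
    qed
  qed (simp add: chain_boundary_def)
  then have chain: "singular_chain p (cylinder p) ?rhs"
    by (intro singular_chain_diff singular_chain_chain_map[OF singular_chain_iterated_subdivision[OF i]]
        singular_chain_chain_map[OF i] cont) auto
  have cycle: "chain_boundary p ?rhs = 0"
  proof (cases "p = 0")
    case False
    then have 1: "solves_prism_equation n (p - Suc 0)"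
      and 2: "p - Suc 0 > 0 \<Longrightarrow> solves_prism_equation n (p - Suc 0 - Suc 0)"
      using less by auto
    have "chain_boundary p (prism n (p - Suc 0) (chain_boundary p ?i)) =
        ?top (p - Suc 0) (chain_boundary p ?i) - ?bot (p - Suc 0) (chain_boundary p ?i)"
      using chain_boundary_prism_step[OF 1 2 di] chain_boundary_boundary[OF i] False by simp
    moreover have "chain_boundary p (?top p ?i) = ?top (p - Suc 0) (chain_boundary p ?i)"
      using chain_boundary_chain_map[OF singular_chain_iterated_subdivision[OF i]]
        chain_boundary_iterated_subdivision[OF i] by metis
    moreover have "chain_boundary p (?bot p ?i) = ?bot (p - Suc 0) (chain_boundary p ?i)"
      using chain_boundary_chain_map[OF i] by metis
    ultimately show ?thesis
      by (simp add: chain_boundary_diff)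
  qed (simp add: chain_boundary_def)
  have const: "chain_map 0 (\<lambda>_. a) ?rhs = 0" if "p = 0" for a :: "(nat \<Rightarrow> real) \<times> real"
  proof -
    have "?Sd 0 (id_simplex 0) = id_simplex 0"
    proof (induction n)
      case (Suc n)
      then show ?case
        using singular_subdivision_zero[OF singular_chain_id_simplex]
        by (simp only: funpow.simps comp_apply)
    qed auto
    then show ?thesis
      using that by (simp add: chain_map_diff chain_boundary_def simplex_map_def o_def)
  qed
  have "\<exists>d. singular_chain (Suc p) (cylinder p) d \<and> chain_boundary (Suc p) d = ?rhs"
    by (rule contractible_space_cycle_is_boundary[OF contractible_cylinder chain cycle const])
  then have "singular_chain (Suc p) (cylinder p) (SOME d. singular_chain (Suc p) (cylinder p) d \<and> chain_boundary (Suc p) d = ?rhs) \<and>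
    chain_boundary (Suc p) (SOME d. singular_chain (Suc p) (cylinder p) d \<and> chain_boundary (Suc p) d = ?rhs) = ?rhs"
    by (rule someI_ex)
  moreover have "prism_model n p = (SOME d. singular_chain (Suc p) (cylinder p) d \<and> chain_boundary (Suc p) d = ?rhs)"
    by (cases p) (simp_all add: prism_def chain_boundary_of)
  ultimately show ?case
    unfolding solves_prism_equation_def by metis
qed

lemma singular_chain_prism_model: "singular_chain (Suc p) (cylinder p) (prism_model n p)"
  using prism_model_solves solves_prism_equation_def by blast

lemma chain_boundary_prism:
  "cs_chain p X c \<Longrightarrow> chain_boundary (Suc p) (prism n p c) =
    chain_map p (\<lambda>x. (x, 1)) ((singular_subdivision p ^^ n) c) - chain_map p (\<lambda>x. (x, 0)) c
    - prism n (p - Suc 0) (chain_boundary p c)"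
  using chain_boundary_prism_step prism_model_solves singular_chain_indiscrete by blast

lemma cs_chain_map_prism:
  assumes "\<And>f. f \<in> Poly_Mapping.keys c \<Longrightarrow>
    cs_continuous (cs_of_topology (cylinder p)) Y (g \<circ> map_prod f id)"
  shows "cs_chain (Suc p) Y (chain_map (Suc p) g (prism n p c))"
proof -
  have "chain_map (Suc p) g (prism n p c)
      = frag_extend (\<lambda>f. chain_map (Suc p) (g \<circ> map_prod f id) (prism_model n p)) c"
    using subset_UNIV
  proof (induction c rule: frag_induction)
    case (one f)
    show ?case
      unfolding prism_def frag_extend_of chain_map_compose by (rule comp_apply[symmetric])
  qed (auto simp: prism_diff chain_map_diff frag_extend_diff)
  moreover have "cs_chain (Suc p) Y (chain_map (Suc p) (g \<circ> map_prod f id) (prism_model n p))"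
    if "f \<in> Poly_Mapping.keys c" for f
    using assms[OF that] cs_chain_chain_map cs_chain_of_singular_chain[OF singular_chain_prism_model]
    by blast
  ultimately show ?thesis
    by (simp add: cs_chain_extend)
qed

section \<open>Homotopies and subdivision\<close>

lemma singular_chain_indiscrete_chain_map: "singular_chain p indiscrete (chain_map p g c)"
  unfolding chain_map_def
  by (intro singular_chain_extend)
    (simp add: singular_chain_of singular_simplex_indiscrete simplex_map_def)

lemma singular_chain_indiscrete_prism: "singular_chain (Suc p) indiscrete (prism n p c)"
  unfolding prism_def by (intro singular_chain_extend singular_chain_indiscrete_chain_map)

lemma chain_boundary_map_prism:
  assumes c: "cs_chain p X c"
  shows "chain_boundary (Suc p) (chain_map (Suc p) g (prism n p c)) =
    chain_map p (\<lambda>x. g (x, 1)) ((singular_subdivision p ^^ n) c) - chain_map p (\<lambda>x. g (x, 0)) c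
    - chain_map p g (prism n (p - Suc 0) (chain_boundary p c))"
proof -
  have "chain_map p g (chain_map p (\<lambda>x. (x, t)) c) = chain_map p (\<lambda>x. g (x, t)) c" for t c
    using chain_map_compose[of p g "\<lambda>x. (x, t)"] by (simp add: o_def fun_eq_iff)
  then show ?thesis
    using chain_boundary_chain_map[OF singular_chain_indiscrete_prism, of p g n c]
    by (simp add: chain_boundary_prism[OF c] chain_map_diff)
qed

text \<open>The two uses are \<open>g = fst\<close>, which shows that subdivision is homotopic to the identity, and
  \<open>n = 0\<close> with \<open>g\<close> a homotopy.  By naturality the operator maps chains of a subspace into a subspace,
  which gives a relative statement.\<close>

lemma prism_homotopy:
  assumes c: "cs_chain p X c" and dc: "cs_chain (p - Suc 0) X' (chain_boundary p c)"
    and X: "\<And>q f. cs_simplex q X f \<Longrightarrow> cs_continuous (cs_of_topology (cylinder q)) Y (g \<circ> map_prod f id)"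
    and X': "\<And>q f. cs_simplex q X' f \<Longrightarrow> cs_continuous (cs_of_topology (cylinder q)) Y' (g \<circ> map_prod f id)"
  shows "\<exists>d e. cs_chain (Suc p) Y d \<and> cs_chain p Y' e \<and>
    chain_map p (\<lambda>x. g (x, 1)) ((singular_subdivision p ^^ n) c)
      = chain_map p (\<lambda>x. g (x, 0)) c + e + chain_boundary (Suc p) d"
proof (intro exI conjI)
  show "cs_chain (Suc p) Y (chain_map (Suc p) g (prism n p c))"
    using c X by (intro cs_chain_map_prism) (auto simp: cs_chain_def)
  show "cs_chain p Y' (chain_map p g (prism n (p - Suc 0) (chain_boundary p c)))"
  proof (cases "p = 0")
    case False
    have "cs_chain (Suc (p - Suc 0)) Y'
        (chain_map (Suc (p - Suc 0)) g (prism n (p - Suc 0) (chain_boundary p c)))"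
      using dc X' by (intro cs_chain_map_prism) (auto simp: cs_chain_def)
    then show ?thesis
      using False by simp
  qed (simp add: chain_boundary_def)
  show "chain_map p (\<lambda>x. g (x, 1)) ((singular_subdivision p ^^ n) c)
      = chain_map p (\<lambda>x. g (x, 0)) c + chain_map p g (prism n (p - Suc 0) (chain_boundary p c))
        + chain_boundary (Suc p) (chain_map (Suc p) g (prism n p c))"
    by (simp add: chain_boundary_map_prism[OF c])
qed

lemma iterated_subdivision_simplex:
  assumes "cs_simplex p X f"
  shows "(singular_subdivision p ^^ n) (frag_of f) = chain_map p f ((singular_subdivision p ^^ n) (id_simplex p))"
proof -
  have "chain_map p f (id_simplex p) = frag_of f"
    using singular_simplex_chain_map_id[of p indiscrete f] assms
    by (simp add: singular_simplex_indiscrete cs_simplex_def)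
  then show ?thesis
    using naturality_iterated_subdivision[OF singular_chain_id_simplex] by metis
qed

lemma cs_chain_iterated_subdivision:
  assumes "cs_chain p X c"
  shows "cs_chain p X ((singular_subdivision p ^^ n) c)"
  using assms unfolding cs_chain_def[of p X c]
proof (induction c rule: frag_induction)
  case (one f)
  then have f: "cs_simplex p X f"
    by simp
  have "cs_chain p X (chain_map p f ((singular_subdivision p ^^ n) (id_simplex p)))"
    by (rule cs_chain_chain_map[OF cs_chain_of_singular_chain[OF
          singular_chain_iterated_subdivision[OF singular_chain_id_simplex]]])
      (use f in \<open>simp add: cs_simplex_def\<close>)
  then show ?case
    by (simp only: iterated_subdivision_simplex[OF f])
qed (auto simp: singular_subdivision_power_diff cs_chain_diff)

lemma cs_continuous_simplex_fst:
  assumes "cs_simplex q X f"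
  shows "cs_continuous (cs_of_topology (cylinder q)) X (f \<circ> fst)"
  using assms cs_continuous_compose[OF continuous_map_imp_cs_continuous[OF continuous_map_fst]]
  unfolding cs_simplex_def by blast

lemma singular_subdivision_homologous:
  assumes c: "cs_chain p X c" and dc: "cs_chain (p - Suc 0) (cs_subspace X S) (chain_boundary p c)"
  shows "\<exists>d e. cs_chain (Suc p) X d \<and> cs_chain p (cs_subspace X S) e \<and>
    (singular_subdivision p ^^ n) c = c + e + chain_boundary (Suc p) d"
proof -
  have fst: "fst \<circ> map_prod f id = f \<circ> fst" for f :: "(nat \<Rightarrow> real) \<Rightarrow> 'a"
    by auto
  have "\<exists>d e. cs_chain (Suc p) X d \<and> cs_chain p (cs_subspace X S) e \<and>
    chain_map p (\<lambda>x. fst (x, 1::real)) ((singular_subdivision p ^^ n) c)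
      = chain_map p (\<lambda>x. fst (x, 0::real)) c + e + chain_boundary (Suc p) d"
    by (rule prism_homotopy[OF c dc, where g = fst]; unfold fst; rule cs_continuous_simplex_fst; assumption)
  then obtain d e where "cs_chain (Suc p) X d" "cs_chain p (cs_subspace X S) e"
    and "chain_map p (\<lambda>x. fst (x, 1::real)) ((singular_subdivision p ^^ n) c)
      = chain_map p (\<lambda>x. fst (x, 0::real)) c + e + chain_boundary (Suc p) d"
    by blast
  moreover have "chain_map p (\<lambda>x. x) c = c"
    by (rule cs_chain_map_id[OF c]) simp
  moreover have "chain_map p (\<lambda>x. x) ((singular_subdivision p ^^ n) c) = (singular_subdivision p ^^ n) c"
    by (rule chain_map_id_gen[OF singular_chain_iterated_subdivision[OF singular_chain_indiscrete[OF c]]]) simp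
  ultimately show ?thesis
    by auto
qed

text \<open>The relative homology of a space that deforms into a subset is trivial, provided that the subset
  stays inside itself during the deformation: the prism over the boundary must remain in \<open>A\<close>.\<close>

lemma deformation_relative_cycle:
  assumes X: "closure_space X" and A: "A \<subseteq> points X"
    and H: "cs_continuous (cs_prod X (cs_of_topology (top_of_set {0..1::real}))) X H"
    and H0: "\<And>x. x \<in> points X \<Longrightarrow> H (x, 0) = x"
    and H1: "\<And>x. x \<in> points X \<Longrightarrow> H (x, 1) \<in> A"
    and HA: "\<And>x t. x \<in> A \<Longrightarrow> t \<in> {0..1} \<Longrightarrow> H (x, t) \<in> A"
    and c: "cs_chain p X c" and dc: "cs_chain (p - Suc 0) (cs_subspace X A) (chain_boundary p c)"
  shows "\<exists>a d. cs_chain p (cs_subspace X A) a \<and> cs_chain (Suc p) X d \<and> c = a + chain_boundary (Suc p) d"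
proof -
  let ?I = "cs_of_topology (top_of_set {0..1::real})"
  have HX: "cs_continuous (cs_of_topology (cylinder q)) X (H \<circ> map_prod f (id :: real \<Rightarrow> real))" if f: "cs_simplex q X f" for q f
  proof -
    have "cs_continuous (cs_of_topology (cylinder q)) ?I snd"
      by (intro continuous_map_imp_cs_continuous continuous_map_snd)
    then have "cs_continuous (cs_of_topology (cylinder q)) (cs_prod X ?I) (\<lambda>z. ((f \<circ> fst) z, snd z))"
      by (intro cs_continuous_pair X closure_space_cs_of_topology cs_continuous_simplex_fst f)
    moreover have "(\<lambda>z. ((f \<circ> fst) z, snd z)) = map_prod f (id :: real \<Rightarrow> real)"
      by auto
    ultimately show ?thesis
      using cs_continuous_compose[OF _ H] by metis
  qed
  have HXA: "cs_continuous (cs_of_topology (cylinder q)) (cs_subspace X A) (H \<circ> map_prod f (id :: real \<Rightarrow> real))"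
    if f: "cs_simplex q (cs_subspace X A) f" for q f
    using f A HX[of q f] HA
    by (auto simp: cs_continuous_into_subspace[OF closure_space_cs_of_topology A] cs_simplex_cong_subspace[OF A] Pi_iff)
  obtain d e where d: "cs_chain (Suc p) X d" and e: "cs_chain p (cs_subspace X A) e"
    and eq: "chain_map p (\<lambda>x. H (x, 1)) c = chain_map p (\<lambda>x. H (x, 0)) c + e + chain_boundary (Suc p) d"
    using prism_homotopy[OF c dc HX HXA, where n = 0] by auto
  have "cs_continuous X (cs_prod X ?I) (\<lambda>x. (x, 1))"
    by (intro cs_continuous_pair X closure_space_cs_of_topology cs_continuous_id cs_continuous_const) simp
  then have "cs_continuous X X (\<lambda>x. H (x, 1))"
    using cs_continuous_compose[OF _ H] by (fastforce simp: o_def)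
  then have "cs_continuous X (cs_subspace X A) (\<lambda>x. H (x, 1))"
    using H1 by (simp add: cs_continuous_into_subspace[OF X A])
  then have "cs_chain p (cs_subspace X A) (chain_map p (\<lambda>x. H (x, 1)) c)"
    by (rule cs_chain_chain_map[OF c])
  moreover have "chain_map p (\<lambda>x. H (x, 0)) c = c"
    by (rule cs_chain_map_id[OF c H0])
  then have "c = (chain_map p (\<lambda>x. H (x, 1)) c - e) + chain_boundary (Suc p) (- d)"
    using eq by (simp add: chain_boundary_minus)
  ultimately show ?thesis
    using d e cs_chain_diff cs_chain_minus by metis
qed

section \<open>Small simplices\<close>

text \<open>The preimage of an interior under a simplex contains an open set around each point mapped into
  that interior.  Hence a cover by interiors pulls back to an open cover of a compact metric space, for
  which the classical statement holds; naturality of subdivision carries it to \<open>X\<close>.\<close>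

lemma small_iterated_subdivision:
  assumes X: "closure_space X" and U: "U \<subseteq> points X" and V: "V \<subseteq> points X"
    and cover: "points X \<subseteq> cs_interior X U \<union> cs_interior X V"
    and c: "cs_chain p X c"
  shows "\<exists>n. \<forall>m\<ge>n. \<exists>u v. cs_chain p (cs_subspace X U) u \<and> cs_chain p (cs_subspace X V) v \<and>
    (singular_subdivision p ^^ m) c = u + v"
  using c unfolding cs_chain_def[of p X c]
proof (induction c rule: frag_induction)
  case zero
  show ?case
    by (intro exI[of _ 0] allI impI exI[of _ 0]) simp
next
  case (one f)
  then have f: "cs_continuous (cs_of_topology (simplex_top p)) X f" and simp_f: "cs_simplex p X f"
    by (simp_all add: cs_simplex_def)
  \<comment> \<open>The interior of the preimage of \<open>W\<close> in the standard simplex.\<close>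
  define O' where "O' W = standard_simplex p - simplex_top p closure_of {t \<in> standard_simplex p. f t \<notin> W}" for W
  have op: "openin (simplex_top p) (O' W)" for W
    unfolding O'_def using openin_diff[OF openin_topspace closedin_closure_of, of "simplex_top p"] by simp
  have sub: "O' W \<subseteq> standard_simplex p" "f ` O' W \<subseteq> W" for W
    using closure_of_subset[of "{t \<in> standard_simplex p. f t \<notin> W}" "simplex_top p"] by (auto simp: O'_def)
  have int: "t \<in> O' W" if t: "t \<in> standard_simplex p" and ft: "f t \<in> cs_interior X W" for t W
  proof (rule ccontr)
    let ?S = "{t \<in> standard_simplex p. f t \<notin> W}"
    assume "t \<notin> O' W"
    then have "f t \<in> cl X (f ` ?S)"
      using cs_continuous_cl[OF f, of ?S t] t by (auto simp: O'_def)
    moreover have "f ` ?S \<subseteq> points X - W"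
      using cs_continuous_points[OF f] by auto
    ultimately show False
      using cl_mono[OF X, of "f ` ?S" "points X - W"] ft by (auto simp: cs_interior_def)
  qed
  have "standard_simplex p \<subseteq> \<Union>{O' U, O' V}"
    using int cover cs_continuous_points[OF f] by fastforce
  then obtain n where n: "\<And>m s. n \<le> m \<Longrightarrow> s \<in> Poly_Mapping.keys ((singular_subdivision p ^^ m) (id_simplex p))
      \<Longrightarrow> \<exists>W\<in>{O' U, O' V}. s \<in> standard_simplex p \<rightarrow> W"
    using sufficient_iterated_singular_subdivision_exists[of "{O' U, O' V}" "simplex_top p" p "id_simplex p"]
      op singular_chain_id_simplex by auto
  show ?case
  proof (intro exI[of _ n] allI impI)
    fix m assume "n \<le> m"
    let ?s = "(singular_subdivision p ^^ m) (id_simplex p)"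
    let ?K = "\<lambda>W. {s. cs_simplex p (cs_subspace (cs_of_topology (simplex_top p)) (O' W)) s}"
    have "cs_chain p (cs_of_topology (simplex_top p)) ?s"
      by (intro cs_chain_of_singular_chain singular_chain_iterated_subdivision singular_chain_id_simplex)
    then have "Poly_Mapping.keys ?s \<subseteq> ?K U \<union> ?K V"
      using n[OF \<open>n \<le> m\<close>] sub(1) by (fastforce simp: cs_chain_def cs_simplex_cong_subspace)
    then obtain a b where a: "Poly_Mapping.keys a \<subseteq> ?K U" and b: "Poly_Mapping.keys b \<subseteq> ?K V" and s: "a + b = ?s"
      by (rule frag_split)
    have push: "cs_chain p (cs_subspace X W) (chain_map p f a)" if "Poly_Mapping.keys a \<subseteq> ?K W" for a W
    proof (rule cs_chain_chain_map)
      show "cs_chain p (cs_subspace (cs_of_topology (simplex_top p)) (O' W)) a"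
        using that by (simp add: cs_chain_def)
      show "cs_continuous (cs_subspace (cs_of_topology (simplex_top p)) (O' W)) (cs_subspace X W) f"
        using sub by (intro cs_continuous_restrict_subspaces f) auto
    qed
    have "(singular_subdivision p ^^ m) (frag_of f) = chain_map p f ?s"
      by (rule iterated_subdivision_simplex[OF simp_f])
    also have "\<dots> = chain_map p f a + chain_map p f b"
      by (simp only: s[symmetric] chain_map_add)
    finally show "\<exists>u v. cs_chain p (cs_subspace X U) u \<and> cs_chain p (cs_subspace X V) v \<and>
        (singular_subdivision p ^^ m) (frag_of f) = u + v"
      using push[OF a] push[OF b] by blast
  qed
next
  case (diff a b)
  then obtain m n where m: "\<And>k. m \<le> k \<Longrightarrow> \<exists>u v. cs_chain p (cs_subspace X U) u \<and> cs_chain p (cs_subspace X V) v \<and>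
      (singular_subdivision p ^^ k) a = u + v"
    and n: "\<And>k. n \<le> k \<Longrightarrow> \<exists>u v. cs_chain p (cs_subspace X U) u \<and> cs_chain p (cs_subspace X V) v \<and>
      (singular_subdivision p ^^ k) b = u + v"
    by blast
  show ?case
  proof (intro exI[of _ "max m n"] allI impI)
    fix k assume "max m n \<le> k"
    then obtain u v u' v' where
      "cs_chain p (cs_subspace X U) u" "cs_chain p (cs_subspace X V) v" "(singular_subdivision p ^^ k) a = u + v"
      "cs_chain p (cs_subspace X U) u'" "cs_chain p (cs_subspace X V) v'" "(singular_subdivision p ^^ k) b = u' + v'"
      using m[of k] n[of k] by auto
    then show "\<exists>u v. cs_chain p (cs_subspace X U) u \<and> cs_chain p (cs_subspace X V) v \<and>
        (singular_subdivision p ^^ k) (a - b) = u + v"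
      by (intro exI[of _ "u - u'"] exI[of _ "v - v'"])
        (auto simp: singular_subdivision_power_diff cs_chain_diff algebra_simps)
  qed
qed

section \<open>Collapsing a closed subset\<close>

lemma collapse_in [simp]: "x \<in> A \<Longrightarrow> collapse A x = A"
  by (simp add: collapse_def)

lemma collapse_eq_A_iff [simp]: "collapse A x = A \<longleftrightarrow> x \<in> A"
  by (auto simp: collapse_def)

lemma collapse_eq_iff: "collapse A x = collapse A y \<longleftrightarrow> x = y \<or> x \<in> A \<and> y \<in> A"
  by (auto simp: collapse_def)

text \<open>A section of the quotient map; its value at the collapsed point is an arbitrary element of
  \<open>A\<close>.\<close>

definition rep :: "'a set \<Rightarrow> 'a" where
  "rep y = (SOME x. x \<in> y)"

lemma rep_collapse [simp]: "x \<notin> A \<Longrightarrow> rep (collapse A x) = x"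
  by (simp add: rep_def collapse_def)

lemma rep_in: "A \<noteq> {} \<Longrightarrow> rep A \<in> A"
  by (simp add: rep_def some_in_eq)

lemma points_cs_quotient [simp]: "points (cs_quotient X A) = collapse A ` points X"
  by (simp add: cs_quotient_def)

lemma cl_cs_quotient [simp]:
  "cl (cs_quotient X A) S = collapse A ` cl X {x \<in> points X. collapse A x \<in> S}"
  by (simp add: cs_quotient_def)

lemma closure_space_quotient:
  assumes X: "closure_space X"
  shows "closure_space (cs_quotient X A)"
  unfolding closure_space_def
proof (intro conjI allI impI)
  show "cl (cs_quotient X A) {} = {}"
    by (simp add: cl_empty[OF X])
  fix S assume S: "S \<subseteq> points (cs_quotient X A)"
  let ?q = "\<lambda>S. {x \<in> points X. collapse A x \<in> S}"
  show "S \<subseteq> cl (cs_quotient X A) S"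
  proof
    fix y assume y: "y \<in> S"
    then obtain x where "x \<in> points X" "y = collapse A x"
      using S by auto
    then show "y \<in> cl (cs_quotient X A) S"
      using y cl_increasing[OF X, of "?q S"] by auto
  qed
  show "cl (cs_quotient X A) S \<subseteq> points (cs_quotient X A)"
    using cl_subset_points[OF X, of "?q S"] by auto
  fix T
  have "?q (S \<union> T) = ?q S \<union> ?q T"
    by auto
  then show "cl (cs_quotient X A) (S \<union> T) = cl (cs_quotient X A) S \<union> cl (cs_quotient X A) T"
    using cl_Un[OF X, of "?q S" "?q T"] by (simp add: image_Un)
qed

lemma cs_continuous_collapse:
  assumes X: "closure_space X"
  shows "cs_continuous X (cs_quotient X A) (collapse A)"
proof (rule cs_continuousI)
  fix S x assume S: "S \<subseteq> points X" and x: "x \<in> cl X S"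
  have "cl X S \<subseteq> cl X {x \<in> points X. collapse A x \<in> collapse A ` S}"
    using S by (intro cl_mono[OF X]) auto
  then show "collapse A x \<in> cl (cs_quotient X A) (collapse A ` S)"
    using x by auto
qed simp

lemma cl_quotient_point:
  assumes "A \<noteq> {}" "cs_closed X A"
  shows "cl (cs_quotient X A) {A} = {A}"
proof -
  have "{x \<in> points X. collapse A x \<in> {A}} = A"
    using assms by (auto simp: cs_closed_def)
  then show ?thesis
    using assms by (auto simp: cs_closed_def)
qed

text \<open>Away from the collapsed set the quotient map is a homeomorphism; this holds because \<open>A\<close> is
  closed.  Excision reduces the comparison of \<open>(X, A)\<close> with its quotient to this region.\<close>

lemma cs_continuous_rep:
  "cs_continuous (cs_subspace (cs_quotient X A) (points (cs_quotient X A) - {A}))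
    (cs_subspace X (points X - A)) rep"
  if X: "closure_space X"
proof (rule cs_continuousI)
  let ?Y = "cs_quotient X A"
  show "rep y \<in> points (cs_subspace X (points X - A))"
    if "y \<in> points (cs_subspace ?Y (points ?Y - {A}))" for y
  proof -
    have y: "y \<in> collapse A ` points X" "y \<noteq> A"
      using that by simp_all
    then obtain x where "x \<in> points X" "y = collapse A x"
      by blast
    then show ?thesis
      using y(2) by simp
  qed
  fix S y assume S: "S \<subseteq> points (cs_subspace ?Y (points ?Y - {A}))"
    and y: "y \<in> cl (cs_subspace ?Y (points ?Y - {A})) S"
  then have "y \<in> collapse A ` cl X {x \<in> points X. collapse A x \<in> S}" "y \<noteq> A"
    by simp_all
  then obtain x where x: "x \<in> cl X {x \<in> points X. collapse A x \<in> S}" and yx: "y = collapse A x"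
    by blast
  then have xA: "x \<notin> A"
    using \<open>y \<noteq> A\<close> by simp
  have "{x \<in> points X. collapse A x \<in> S} = rep ` S"
  proof (intro equalityI subsetI)
    fix z assume z: "z \<in> {x \<in> points X. collapse A x \<in> S}"
    then have "z \<notin> A"
      using S by auto
    then show "z \<in> rep ` S"
      using z rep_collapse by (metis (mono_tags, lifting) image_eqI mem_Collect_eq)
  next
    fix z assume "z \<in> rep ` S"
    then obtain w where w: "w \<in> S" "z = rep w"
      by blast
    then have "w \<in> collapse A ` points X" "w \<noteq> A"
      using S by auto
    moreover from this obtain v where "v \<in> points X" "w = collapse A v"
      by blast
    ultimately show "z \<in> {x \<in> points X. collapse A x \<in> S}"
      using w by simp
  qed
  moreover have "x \<in> points X"
    using x cl_subset_points[OF X, of "{x \<in> points X. collapse A x \<in> S}"] by auto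
  ultimately show "rep y \<in> cl (cs_subspace X (points X - A)) (rep ` S)"
    using x xA yx by auto
qed

lemma collapse_rep:
  assumes "A \<noteq> {}" "y \<in> points (cs_quotient X A)"
  shows "collapse A (rep y) = y"
proof -
  obtain x where "y = collapse A x"
    using assms by auto
  then show ?thesis
    using assms(1) by (cases "x \<in> A") (auto simp: rep_in)
qed

text \<open>The complement of a closed set is its own interior, and the interior of a neighbourhood of \<open>A\<close>
  covers the rest.\<close>

lemma cs_interior_cover:
  assumes "cs_closed X A" "cs_nbhd X A B"
  shows "points X \<subseteq> cs_interior X (points X - A) \<union> cs_interior X B"
proof -
  have "points X - (points X - A) = A"
    using assms(1) by (auto simp: cs_closed_def)
  then show ?thesis
    using assms by (auto simp: cs_closed_def cs_nbhd_def cs_interior_def)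
qed

lemma cs_nbhd_quotient:
  assumes X: "closure_space X" and A: "A \<noteq> {}" and B: "cs_nbhd X A B"
  shows "cs_nbhd (cs_quotient X A) {A} (collapse A ` B)"
proof -
  have AB: "A \<subseteq> B" and BX: "B \<subseteq> points X" and Ai: "A \<inter> cl X (points X - B) = {}"
    using B by (auto simp: cs_nbhd_def cs_interior_def)
  have "{x \<in> points X. collapse A x \<in> collapse A ` points X - collapse A ` B} = points X - B"
    using AB by (auto simp: collapse_eq_iff image_iff)
  moreover obtain a where "a \<in> A"
    using A by blast
  then have "A \<in> collapse A ` B" "A \<in> collapse A ` points X"
    using AB BX imageI[of a _ "collapse A"] by auto
  moreover have "A \<notin> collapse A ` cl X (points X - B)"
    using Ai by (metis collapse_eq_A_iff disjoint_iff imageE)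
  ultimately show ?thesis
    using BX by (auto simp: cs_nbhd_def cs_interior_def)
qed

lemma cs_nbhd_Int:
  assumes X: "closure_space X" and U: "cs_nbhd X S U" and V: "cs_nbhd X S V"
  shows "cs_nbhd X S (U \<inter> V)"
proof -
  have "cl X (points X - U \<inter> V) = cl X (points X - U) \<union> cl X (points X - V)"
    using cl_Un[OF X, of "points X - U" "points X - V"] by (simp add: Diff_Int)
  then show ?thesis
    using U V by (auto simp: cs_nbhd_def cs_interior_def)
qed

lemma cs_nbhd_points: "closure_space X \<Longrightarrow> S \<subseteq> points X \<Longrightarrow> cs_nbhd X S (points X)"
  by (simp add: cs_nbhd_def cs_interior_def cl_empty)

lemma cs_nbhd_finite_Inter:
  assumes X: "closure_space X" and S: "S \<subseteq> points X" and "finite F" "\<And>s. s \<in> F \<Longrightarrow> cs_nbhd X S (U s)"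
  shows "cs_nbhd X S (points X \<inter> (\<Inter>s\<in>F. U s))"
  using assms(3,4)
proof (induction F rule: finite_induct)
  case empty
  then show ?case
    using cs_nbhd_points[OF X S] by simp
next
  case (insert s F)
  then have "cs_nbhd X S (points X \<inter> (\<Inter>s\<in>F. U s))" "cs_nbhd X S (U s)"
    by auto
  from cs_nbhd_Int[OF X this(2,1)] show ?case
    by (simp add: Int_left_commute)
qed

lemma finite_cover_of_interval:
  fixes V :: "real \<Rightarrow> real set"
  defines "I \<equiv> cs_of_topology (top_of_set {0..1::real})"
  assumes V: "\<And>s. s \<in> {0..1} \<Longrightarrow> cs_nbhd I {s} (V s)"
  shows "\<exists>F\<subseteq>{0..1}. finite F \<and> {0..1} \<subseteq> (\<Union>s\<in>F. V s)"
proof -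
  let ?T = "top_of_set {0..1::real}" and ?J = "\<lambda>s. cs_interior I (V s)"
  have J: "?J s = topspace ?T - ?T closure_of (topspace ?T - V s)" for s
    by (simp add: cs_interior_def I_def)
  have op: "openin ?T (?J s)" for s
    unfolding J by (intro openin_diff openin_topspace closedin_closure_of)
  have JV: "?J s \<subseteq> V s" for s
    using closure_of_subset[of "topspace ?T - V s" ?T] by (auto simp: J)
  have mem: "s \<in> ?J s" if "s \<in> {0..1}" for s
    using V[OF that] by (simp add: cs_nbhd_def)
  have "compactin ?T {0..1}"
    by (simp add: compactin_subtopology)
  moreover have "openin ?T W" if "W \<in> ?J ` {0..1}" for W
    using that op by (elim imageE) (simp only:)
  moreover have "{0..1} \<subseteq> \<Union>(?J ` {0..1})"
    using mem by (intro subsetI UN_I) simp_all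
  ultimately have "\<exists>\<F>. finite \<F> \<and> \<F> \<subseteq> ?J ` {0..1} \<and> {0..1} \<subseteq> \<Union>\<F>"
    by (rule compactinD)
  then obtain \<F> where \<F>: "finite \<F>" "\<F> \<subseteq> ?J ` {0..1}" "{0..1} \<subseteq> \<Union>\<F>"
    by (elim exE conjE)
  obtain F where F: "F \<subseteq> {0..1}" "finite F" "\<F> = ?J ` F"
    using finite_subset_image[OF \<F>(1,2)] by (elim exE conjE)
  have "\<Union>\<F> \<subseteq> (\<Union>s\<in>F. V s)"
    unfolding F(3) using JV by (intro UN_mono) simp_all
  then show ?thesis
    using F(1,2) \<F>(3) by (intro exI[of _ F] conjI) (simp_all only: order_trans)
qed

lemma tube_lemma:
  fixes Z :: "'a closure_space"
  defines "I \<equiv> cs_of_topology (top_of_set {0..1::real})"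
  assumes Z: "closure_space Z" and a: "a \<in> points Z"
    and nb: "\<And>s. s \<in> {0..1} \<Longrightarrow> \<exists>U V. cs_nbhd Z {a} U \<and> cs_nbhd I {s} V \<and> (U \<times> V) \<inter> S = {}"
  shows "\<exists>U. cs_nbhd Z {a} U \<and> (U \<times> {0..1}) \<inter> S = {}"
proof -
  obtain U V where U: "\<And>s. s \<in> {0..1} \<Longrightarrow> cs_nbhd Z {a} (U s)"
    and V: "\<And>s. s \<in> {0..1} \<Longrightarrow> cs_nbhd I {s} (V s)"
    and UV: "\<And>s. s \<in> {0..1} \<Longrightarrow> (U s \<times> V s) \<inter> S = {}"
    using nb by metis
  have "\<exists>F\<subseteq>{0..1}. finite F \<and> {0..1} \<subseteq> (\<Union>s\<in>F. V s)"
    using V unfolding I_def by (rule finite_cover_of_interval)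
  then obtain F where F: "F \<subseteq> {0..1}" "finite F" "{0..1} \<subseteq> (\<Union>s\<in>F. V s)"
    by (elim exE conjE)
  let ?U = "points Z \<inter> (\<Inter>s\<in>F. U s)"
  have "cs_nbhd Z {a} ?U"
    using a U F by (intro cs_nbhd_finite_Inter Z) auto
  moreover have "(?U \<times> {0..1}) \<inter> S = {}"
  proof (rule equals0I)
    fix w assume w: "w \<in> (?U \<times> {0..1}) \<inter> S"
    obtain u v where uv: "w = (u, v)"
      by (cases w)
    then obtain s where s: "s \<in> F" "v \<in> V s"
      using w F(3) by blast
    then show False
      using UV[of s] F(1) w uv by blast
  qed
  ultimately show ?thesis
    by blast
qed

text \<open>
  At the collapsed point continuity is a uniform statement over all points of \<open>A\<close>, and continuity of
  \<open>H\<close> by itself would let the range of times on which a neighbourhood works shrink along \<open>A\<close>.  Since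
  \<open>H\<close> keeps \<open>A\<close> inside \<open>A\<close>, compactness of the interval gives each point of \<open>A\<close> one neighbourhood
  that works for all times; their union is a neighbourhood of \<open>A\<close>.  Away from \<open>A\<close> the quotient map is a
  homeomorphism and nothing has to be shown beyond continuity of \<open>H\<close>.
\<close>

lemma cs_continuous_quotient_homotopy:
  fixes X :: "'a closure_space"
  assumes X: "closure_space X" and A: "A \<noteq> {}" and clA: "cs_closed X A" and AB: "A \<subseteq> B" and BX: "B \<subseteq> points X"
    and H: "cs_continuous (cs_prod (cs_subspace X B) (cs_of_topology (top_of_set {0..1::real}))) (cs_subspace X B) H"
    and HA: "\<And>a t. a \<in> A \<Longrightarrow> t \<in> {0..1} \<Longrightarrow> H (a, t) \<in> A"
  defines "B' \<equiv> cs_subspace (cs_quotient X A) (collapse A ` B)"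
  shows "cs_continuous (cs_prod B' (cs_of_topology (top_of_set {0..1::real}))) B' (\<lambda>(y, t). collapse A (H (rep y, t)))"
proof (rule cs_continuousI)
  let ?q = "collapse A" and ?I = "cs_of_topology (top_of_set {0..1::real})" and ?XB = "cs_subspace X B"
  let ?h = "\<lambda>(y, t). collapse A (H (rep y, t))"
  have XB: "closure_space ?XB"
    by (rule closure_space_subspace[OF X BX])
  have I: "closure_space ?I"
    by (rule closure_space_cs_of_topology)
  have ptsB': "points B' = ?q ` B"
    by (simp add: B'_def)
  have repB: "rep y \<in> B" if "y \<in> ?q ` B" for y
    using that rep_in[OF A] AB by (force simp: collapse_def rep_def)
  have HB: "H (x, t) \<in> B" if "x \<in> B" "t \<in> {0..1}" for x t
    using cs_continuous_points[OF H, of "(x, t)"] that by simp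
  have hq: "?h (?q x, t) = ?q (H (x, t))" if "x \<in> B" "t \<in> {0..1}" for x t
    using that rep_in[OF A] HA by (cases "x \<in> A") auto
  show "?h z \<in> points B'" if "z \<in> points (cs_prod B' ?I)" for z
    using that HB repB by (auto simp: ptsB')
  fix S z assume S: "S \<subseteq> points (cs_prod B' ?I)" and z: "z \<in> cl (cs_prod B' ?I) S"
  obtain y t where zyt: "z = (y, t)"
    by (cases z)
  have y: "y \<in> ?q ` B" and t: "t \<in> {0..1}"
    and meet: "\<And>U V. cs_nbhd B' {y} U \<Longrightarrow> cs_nbhd ?I {t} V \<Longrightarrow> (U \<times> V) \<inter> S \<noteq> {}"
    using z by (auto simp: zyt cs_prod_def ptsB')
  \<comment> \<open>Closures in a quotient are computed upstairs, so \<open>S\<close> and its image give way to preimages.\<close>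
  define S' where "S' = {(x, s). x \<in> B \<and> s \<in> {0..1} \<and> (?q x, s) \<in> S}"
  define K where "K = {x \<in> points X. ?q x \<in> ?h ` S}"
  have HS': "H ` S' \<subseteq> K"
  proof clarify
    fix x s assume "(x, s) \<in> S'"
    then have "x \<in> B" "s \<in> {0..1}" "(?q x, s) \<in> S"
      by (auto simp: S'_def)
    then show "H (x, s) \<in> K"
      using HB[of x s] BX hq[of x s] by (force simp: K_def image_iff)
  qed
  have KX: "K \<subseteq> points X"
    by (auto simp: K_def)
  \<comment> \<open>Continuity of the given homotopy, stated in terms of neighbourhoods.\<close>
  have nb: "\<exists>U V. cs_nbhd ?XB {x} U \<and> cs_nbhd ?I {s} V \<and> (U \<times> V) \<inter> S' = {}"
    if x: "x \<in> B" and s: "s \<in> {0..1}" and n: "H (x, s) \<notin> cl X K" for x s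
  proof (rule ccontr)
    assume "\<not> ?thesis"
    then have "(x, s) \<in> cl (cs_prod ?XB ?I) S'"
      using x s unfolding cs_prod_def by auto
    moreover have "S' \<subseteq> points (cs_prod ?XB ?I)"
      by (auto simp: S'_def)
    ultimately have "H (x, s) \<in> cl X (H ` S')"
      using cs_continuous_cl[OF H] by auto
    then show False
      using n cl_mono[OF X HS' KX] by blast
  qed
  have "?h (y, t) \<in> ?q ` cl X K"
  proof (rule ccontr)
    assume not: "?h (y, t) \<notin> ?q ` cl X K"
    show False
    proof (cases "y = A")
      case False
      obtain x where x: "x \<in> B" "y = ?q x"
        using y by blast
      then have xA: "x \<notin> A"
        using False by simp
      have "H (x, t) \<notin> cl X K"
        using not hq[OF x(1) t] x(2) by auto
      then obtain U V where U: "cs_nbhd ?XB {x} U" and V: "cs_nbhd ?I {t} V" and UV: "(U \<times> V) \<inter> S' = {}"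
        using nb[OF x(1) t] by blast
      have UB: "U \<subseteq> B" and xU: "x \<in> U" and xint: "x \<notin> cl X (B - U)"
        using U x(1) by (auto simp: cs_nbhd_def cs_interior_def)
      have "cs_nbhd B' {y} (?q ` (U - A))"
      proof -
        have pre: "{v \<in> points X. ?q v \<in> ?q ` B - ?q ` (U - A)} \<subseteq> (B - U) \<union> A"
          using AB by (auto simp: collapse_eq_iff)
        have "cl X {v \<in> points X. ?q v \<in> ?q ` B - ?q ` (U - A)} \<subseteq> cl X ((B - U) \<union> A)"
          using BX AB by (intro cl_mono[OF X pre]) auto
        also have "\<dots> = cl X (B - U) \<union> A"
          using clA cl_Un[OF X, of "B - U" A] BX AB by (auto simp: cs_closed_def)
        finally have "?q x \<notin> ?q ` cl X {v \<in> points X. ?q v \<in> ?q ` B - ?q ` (U - A)}"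
          using xint xA by (auto simp: collapse_eq_iff)
        then show ?thesis
          using xU UB x xA by (auto simp: cs_nbhd_def cs_interior_def B'_def)
      qed
      then obtain u v where "(?q u, v) \<in> S" "u \<in> U" "v \<in> V"
        using meet[OF _ V] by fastforce
      moreover have "v \<in> {0..1}"
        using V \<open>v \<in> V\<close> by (auto simp: cs_nbhd_def)
      ultimately show False
        using UV UB by (auto simp: S'_def)
    next
      case True
      have "?h (y, t) = A"
        using True HA[OF rep_in[OF A] t] by simp
      then have disj: "A \<inter> cl X K = {}"
        using not by (metis collapse_in disjoint_iff image_eqI)
      have "\<exists>U. cs_nbhd ?XB {a} U \<and> (U \<times> {0..1}) \<inter> S' = {}" if a: "a \<in> A" for a
      proof -
        have "\<exists>U V. cs_nbhd ?XB {a} U \<and> cs_nbhd ?I {s} V \<and> (U \<times> V) \<inter> S' = {}" if s: "s \<in> {0..1}" for s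
          using nb[of a s] disj HA[OF a s] a AB s by blast
        then show ?thesis
          using a AB by (intro tube_lemma XB) auto
      qed
      then obtain U where U: "\<And>a. a \<in> A \<Longrightarrow> cs_nbhd ?XB {a} (U a)"
        and US: "\<And>a. a \<in> A \<Longrightarrow> (U a \<times> {0..1}) \<inter> S' = {}"
        by metis
      define W where "W = (\<Union>a\<in>A. U a)"
      have UB: "U a \<subseteq> B" and aU: "a \<in> U a" and aint: "a \<notin> cl X (B - U a)" if "a \<in> A" for a
        using U[OF that] that AB by (auto simp: cs_nbhd_def cs_interior_def)
      have "cs_nbhd B' {y} (?q ` W)"
      proof -
        have not_cl: "A \<notin> ?q ` cl X {v \<in> points X. ?q v \<in> ?q ` B - ?q ` W}"
        proof (rule notI)
          assume "A \<in> ?q ` cl X {v \<in> points X. ?q v \<in> ?q ` B - ?q ` W}"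
          then obtain a where a: "a \<in> cl X {v \<in> points X. ?q v \<in> ?q ` B - ?q ` W}" "?q a = A"
            by (elim imageE) (rule that, assumption, rule sym)
          then have aA: "a \<in> A"
            by simp
          have "{v \<in> points X. ?q v \<in> ?q ` B - ?q ` W} \<subseteq> B - U a"
          proof
            fix v assume v: "v \<in> {v \<in> points X. ?q v \<in> ?q ` B - ?q ` W}"
            then obtain b where "b \<in> B" "?q v = ?q b"
              by blast
            then have "v \<in> B"
              using AB by (auto simp: collapse_eq_iff)
            moreover have "v \<notin> U a"
              using v aA by (auto simp: W_def)
            ultimately show "v \<in> B - U a"
              by simp
          qed
          then have "cl X {v \<in> points X. ?q v \<in> ?q ` B - ?q ` W} \<subseteq> cl X (B - U a)"
            using BX by (intro cl_mono[OF X]) auto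
          then show False
            using a(1) aint[OF aA] by blast
        qed
        moreover obtain a where "a \<in> A"
          using A by blast
        moreover from this have "a \<in> W" "a \<in> B"
          using AB aU unfolding W_def by blast+
        ultimately have "A \<in> ?q ` W" "A \<in> ?q ` B"
          using imageI[of a W ?q] imageI[of a B ?q] by simp_all
        moreover have "?q ` W \<subseteq> ?q ` B"
          using UB by (auto simp: W_def)
        ultimately show ?thesis
          using not_cl by (simp add: cs_nbhd_def cs_interior_def B'_def True)
      qed
      moreover have "cs_nbhd ?I {t} {0..1}"
        using cs_nbhd_points[OF I, of "{t}"] t by simp
      ultimately have "((?q ` W) \<times> {0..1}) \<inter> S \<noteq> {}"
        by (rule meet)
      then obtain u v a where uv: "(?q u, v) \<in> S" "a \<in> A" "u \<in> U a" "v \<in> {0..1}"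
        unfolding W_def by blast
      then have "(u, v) \<in> S'"
        using UB[of a] by (simp add: S'_def subset_iff)
      then show False
        using US[OF uv(2)] uv(3,4) by blast
    qed
  qed
  moreover have "?h (y, t) \<in> ?q ` B"
    using HB[OF repB[OF y] t] by simp
  moreover have "cl B' (?h ` S) = ?q ` B \<inter> ?q ` cl X K"
    unfolding B'_def K_def cl_cs_subspace cl_cs_quotient by (rule refl)
  ultimately show "?h z \<in> cl B' (?h ` S)"
    unfolding zyt by blast
qed

section \<open>Excision\<close>

lemma cs_subspace_subspace: "S \<subseteq> T \<Longrightarrow> cs_subspace (cs_subspace X T) S = cs_subspace X S"
  by (auto simp: cs_subspace_def fun_eq_iff)

text \<open>The homotopy \<open>H\<close> deforms \<open>B\<close> into \<open>A\<close>; the retraction is its end map.\<close>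

locale good_pair =
  fixes X :: "'a closure_space" and A B :: "'a set" and H :: "'a \<times> real \<Rightarrow> 'a"
  assumes X: "closure_space X" and A: "A \<noteq> {}" and closed_A: "cs_closed X A" and B: "cs_nbhd X A B"
    and H: "cs_continuous (cs_prod (cs_subspace X B) (cs_of_topology (top_of_set {0..1::real}))) (cs_subspace X B) H"
    and H_0: "\<And>x. x \<in> B \<Longrightarrow> H (x, 0) = x"
    and H_1: "\<And>x. x \<in> B \<Longrightarrow> H (x, 1) \<in> A"
    and H_A: "\<And>x t. x \<in> A \<Longrightarrow> t \<in> {0..1} \<Longrightarrow> H (x, t) \<in> A"
begin

abbreviation q :: "'a \<Rightarrow> 'a set" where "q \<equiv> collapse A"
abbreviation Y :: "'a set closure_space" where "Y \<equiv> cs_quotient X A"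

lemma AX: "A \<subseteq> points X"
  using closed_A by (simp add: cs_closed_def)

lemma AB: "A \<subseteq> B" and BX: "B \<subseteq> points X"
  using B by (auto simp: cs_nbhd_def)

lemma Y: "closure_space Y"
  by (rule closure_space_quotient[OF X])

lemma A_in_qB: "A \<in> q ` B"
proof -
  obtain a where "a \<in> A"
    using A by blast
  then show ?thesis
    using AB imageI[of a B q] by auto
qed

lemma A_in_Y: "{A} \<subseteq> points Y"
  using A_in_qB BX by auto

lemma qB_Y: "q ` B \<subseteq> points Y"
  using BX by auto

lemma deformation_B:
  assumes "cs_chain p (cs_subspace X B) b" "cs_chain (p - Suc 0) (cs_subspace X A) (chain_boundary p b)"
  shows "\<exists>a d. cs_chain p (cs_subspace X A) a \<and> cs_chain (Suc p) (cs_subspace X B) d \<and>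
    b = a + chain_boundary (Suc p) d"
  using deformation_relative_cycle[OF closure_space_subspace[OF X BX] _ H H_0 H_1 H_A, of p b] AB assms
  by (simp add: cs_subspace_subspace)

lemma deformation_quotient_B:
  assumes "cs_chain p (cs_subspace Y (q ` B)) b" "cs_chain (p - Suc 0) (cs_subspace Y {A}) (chain_boundary p b)"
  shows "\<exists>a d. cs_chain p (cs_subspace Y {A}) a \<and> cs_chain (Suc p) (cs_subspace Y (q ` B)) d \<and>
    b = a + chain_boundary (Suc p) d"
proof -
  let ?B' = "cs_subspace Y (q ` B)" and ?h = "\<lambda>(y, t). q (H (rep y, t))"
  have repB: "rep y \<in> B" if "y \<in> q ` B" for y
    using that rep_in[OF A] AB by (force simp: collapse_def rep_def)
  have qrep: "q (rep y) = y" if "y \<in> q ` B" for y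
    using that qB_Y by (intro collapse_rep[OF A, of y X]) auto
  have h: "cs_continuous (cs_prod ?B' (cs_of_topology (top_of_set {0..1::real}))) ?B' ?h"
    by (rule cs_continuous_quotient_homotopy[OF X A closed_A AB BX H H_A])
  have h0: "?h (y, 0) = y" and h1: "?h (y, 1) \<in> {A}" if "y \<in> points ?B'" for y
    using that repB[of y] qrep[of y] H_0[of "rep y"] H_1[of "rep y"] by simp_all
  have hA: "?h (y, t) \<in> {A}" if "y \<in> {A}" "t \<in> {0..1}" for y t
    using that H_A[OF rep_in[OF A]] by simp
  show ?thesis
    using deformation_relative_cycle[OF closure_space_subspace[OF Y qB_Y] _ h h0 h1 hA, of p b] A_in_qB assms
    by (simp add: cs_subspace_subspace)
qed

lemma cover_X: "points X \<subseteq> cs_interior X (points X - A) \<union> cs_interior X B"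
  by (rule cs_interior_cover[OF closed_A B])

lemma cover_Y: "points Y \<subseteq> cs_interior Y (points Y - {A}) \<union> cs_interior Y (q ` B)"
  using cs_interior_cover[of Y "{A}" "q ` B"] cl_quotient_point[OF A closed_A] A_in_Y cs_nbhd_quotient[OF X A B]
  by (simp add: cs_closed_def)

lemma q_continuous: "cs_continuous X Y q"
  by (rule cs_continuous_collapse[OF X])

lemma q_A: "cs_continuous (cs_subspace X A) (cs_subspace Y {A}) q"
  by (rule cs_continuous_restrict_subspaces[OF q_continuous AX]) auto

lemma q_B: "cs_continuous (cs_subspace X B) (cs_subspace Y (q ` B)) q"
  by (rule cs_continuous_restrict_subspaces[OF q_continuous BX]) auto

lemma q_off_A: "cs_continuous (cs_subspace X (points X - A)) (cs_subspace Y (points Y - {A})) q"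
  by (rule cs_continuous_restrict_subspaces[OF q_continuous]) auto

lemma rep_chain:
  "cs_chain p (cs_subspace Y (points Y - {A})) u \<Longrightarrow> cs_chain p (cs_subspace X (points X - A)) (chain_map p rep u)"
  by (erule cs_chain_chain_map) (rule cs_continuous_rep[OF X])

text \<open>A chain of \<open>Y - *\<close> that also lies in the image of \<open>B\<close> lies there simplex by simplex, so its lift
  lies in \<open>B\<close>.\<close>

lemma rep_chain_B:
  assumes u: "cs_chain p (cs_subspace Y (points Y - {A})) u" and uB: "cs_chain p (cs_subspace Y (q ` B)) u"
  shows "cs_chain p (cs_subspace X B) (chain_map p rep u)"
proof -
  let ?S = "(points Y - {A}) \<inter> q ` B"
  have repB: "rep y \<in> B - A" if y: "y \<in> ?S" for y
  proof -
    obtain x where "x \<in> B" "y = q x"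
      using y by blast
    then show ?thesis
      using y by simp
  qed
  have "cs_continuous (cs_subspace (cs_subspace Y (points Y - {A})) ?S) (cs_subspace (cs_subspace X (points X - A)) (B - A)) rep"
    by (rule cs_continuous_restrict_subspaces[OF cs_continuous_rep[OF X]]) (use repB in auto)
  then have "cs_continuous (cs_subspace Y ?S) (cs_subspace X (B - A)) rep"
    using BX by (subst (asm) (1 2) cs_subspace_subspace) auto
  moreover have "cs_chain p (cs_subspace Y ?S) u"
    using u uB qB_Y by (intro cs_chain_subspace_Int) auto
  ultimately have "cs_chain p (cs_subspace X (B - A)) (chain_map p rep u)"
    using cs_chain_chain_map by blast
  then show ?thesis
    using BX by (auto intro: cs_chain_subspace_mono)
qed

lemma chain_map_q_rep:
  assumes "cs_chain p (cs_subspace Y (points Y - {A})) u"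
  shows "chain_map p q (chain_map p rep u) = u"
proof -
  have "chain_map p (q \<circ> rep) u = u"
    by (rule cs_chain_map_id[OF assms]) (use collapse_rep[OF A] in auto)
  then show ?thesis
    by (simp add: chain_map_compose)
qed

lemma chain_map_rep_q:
  assumes "cs_chain p (cs_subspace X (points X - A)) u"
  shows "chain_map p rep (chain_map p q u) = u"
proof -
  have "chain_map p (rep \<circ> q) u = u"
    by (rule cs_chain_map_id[OF assms]) auto
  then show ?thesis
    by (simp add: chain_map_compose)
qed

text \<open>Surjectivity of \<open>q\<close> on relative homology.  After subdivision a relative cycle of \<open>Y\<close> is \<open>u + b\<close> with
  \<open>u\<close> off \<open>*\<close> and \<open>b\<close> in the image of \<open>B\<close>.  The lift of \<open>u\<close> has its boundary in \<open>B\<close>; the deformation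
  corrects this boundary into \<open>A\<close> at the cost of a chain \<open>b1\<close> in \<open>B\<close>.  The error made in \<open>Y\<close> is a relative
  cycle of \<open>(q B, *)\<close>, hence negligible.\<close>

lemma lift_relative_cycle:
  assumes z: "cs_chain p Y z" and dz: "cs_chain (p - Suc 0) (cs_subspace Y {A}) (chain_boundary p z)"
  shows "\<exists>x e y. cs_chain p X x \<and> cs_chain (p - Suc 0) (cs_subspace X A) (chain_boundary p x) \<and>
    cs_chain p (cs_subspace Y {A}) e \<and> cs_chain (Suc p) Y y \<and>
    chain_map p q x = z + e + chain_boundary (Suc p) y"
proof -
  obtain n u b where u: "cs_chain p (cs_subspace Y (points Y - {A})) u"
    and b: "cs_chain p (cs_subspace Y (q ` B)) b" and ub: "(singular_subdivision p ^^ n) z = u + b"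
    using small_iterated_subdivision[OF Y _ qB_Y cover_Y z] by blast
  obtain d1 e1 where d1: "cs_chain (Suc p) Y d1" and e1: "cs_chain p (cs_subspace Y {A}) e1"
    and sd: "(singular_subdivision p ^^ n) z = z + e1 + chain_boundary (Suc p) d1"
    using singular_subdivision_homologous[OF z dz] by blast
  have dsd: "chain_boundary p (u + b) = chain_boundary p z + chain_boundary p e1"
    using cs_chain_boundary_boundary[OF d1] sd ub by (simp add: chain_boundary_add)
  have dub: "cs_chain (p - Suc 0) (cs_subspace Y {A}) (chain_boundary p (u + b))"
    unfolding dsd by (intro cs_chain_add dz cs_chain_boundary e1)
  have "cs_chain (p - Suc 0) (cs_subspace Y (q ` B)) (chain_boundary p (u + b) - chain_boundary p b)"
    using A_in_qB by (intro cs_chain_diff[OF cs_chain_subspace_mono[OF dub _ qB_Y] cs_chain_boundary[OF b]]) simp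
  then have duB: "cs_chain (p - Suc 0) (cs_subspace Y (q ` B)) (chain_boundary p u)"
    by (simp add: chain_boundary_add)
  define x0 where "x0 = chain_map p rep u"
  have x0: "cs_chain p (cs_subspace X (points X - A)) x0" and qx0: "chain_map p q x0 = u"
    using rep_chain[OF u] chain_map_q_rep[OF u] by (simp_all add: x0_def)
  have x0X: "cs_chain p X x0"
    by (rule cs_chain_subspace_imp[OF x0]) auto
  have "chain_boundary p x0 = chain_map (p - Suc 0) rep (chain_boundary p u)"
    unfolding x0_def by (rule cs_chain_boundary_chain_map[OF u])
  then have dx0: "cs_chain (p - Suc 0) (cs_subspace X B) (chain_boundary p x0)"
    using rep_chain_B[OF cs_chain_boundary[OF u] duB] by simp
  \<comment> \<open>In dimension 0 there is no boundary to correct, and \<open>p - Suc 0\<close> is not the degree below \<open>p\<close>.\<close>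
  have "\<exists>a b1. cs_chain (p - Suc 0) (cs_subspace X A) a \<and> cs_chain p (cs_subspace X B) b1 \<and>
      chain_boundary p x0 = a + chain_boundary p b1"
  proof (cases p)
    case 0
    then show ?thesis
      by (intro exI[of _ 0]) (simp add: chain_boundary_def)
  next
    case (Suc k)
    then show ?thesis
      using deformation_B[OF dx0] cs_chain_boundary_boundary[OF x0] by simp
  qed
  then obtain a b1 where a: "cs_chain (p - Suc 0) (cs_subspace X A) a" and b1: "cs_chain p (cs_subspace X B) b1"
    and ab1: "chain_boundary p x0 = a + chain_boundary p b1"
    by blast
  define x where "x = x0 - b1"
  have x: "cs_chain p X x"
    unfolding x_def using cs_chain_subspace_imp[OF b1 BX] x0X by (intro cs_chain_diff)
  have dx: "chain_boundary p x = a"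
    by (simp add: x_def chain_boundary_diff ab1)
  have qx: "chain_map p q x = u - chain_map p q b1"
    by (simp add: x_def chain_map_diff qx0)
  define b2 where "b2 = b + chain_map p q b1"
  have b2: "cs_chain p (cs_subspace Y (q ` B)) b2"
    unfolding b2_def by (intro cs_chain_add b cs_chain_chain_map[OF b1 q_B])
  have "b2 = (u + b) - chain_map p q x"
    by (simp add: b2_def qx)
  then have "chain_boundary p b2 = chain_boundary p (u + b) - chain_map (p - Suc 0) q a"
    using cs_chain_boundary_chain_map[OF x, of q] dx by (simp add: chain_boundary_diff)
  then have "cs_chain (p - Suc 0) (cs_subspace Y {A}) (chain_boundary p b2)"
    using cs_chain_diff[OF dub cs_chain_chain_map[OF a q_A]] by simp
  then obtain e2 d2 where e2: "cs_chain p (cs_subspace Y {A}) e2" and d2: "cs_chain (Suc p) (cs_subspace Y (q ` B)) d2"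
    and b2_eq: "b2 = e2 + chain_boundary (Suc p) d2"
    using deformation_quotient_B[OF b2] by blast
  have "chain_map p q x = z + (e1 - e2) + chain_boundary (Suc p) (d1 - d2)"
    using sd ub \<open>b2 = (u + b) - chain_map p q x\<close> b2_eq
    by (simp add: chain_boundary_diff algebra_simps)
  moreover have "cs_chain (Suc p) Y (d1 - d2)"
    using d1 cs_chain_subspace_imp[OF d2 qB_Y] by (rule cs_chain_diff)
  ultimately show ?thesis
    using x a dx cs_chain_diff[OF e1 e2] by metis
qed

text \<open>Injectivity of \<open>q\<close> on relative homology.  Up to a chain of \<open>*\<close>, the image of \<open>x\<close> is the boundary
  of \<open>y\<close>.  Subdivide \<open>x\<close> and \<open>y\<close> equally often, and subtract from \<open>x\<close> the boundary of the lift of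
  the part of \<open>y\<close> off \<open>*\<close>.  What remains lies in \<open>B\<close>: its part off \<open>A\<close> is determined by its image,
  which lies in the image of \<open>B\<close>.  The deformation then pushes it into \<open>A\<close>.\<close>

lemma relative_boundary_if_quotient_boundary:
  assumes x: "cs_chain p X x" and dx: "cs_chain (p - Suc 0) (cs_subspace X A) (chain_boundary p x)"
    and e: "cs_chain p (cs_subspace Y {A}) e" and y: "cs_chain (Suc p) Y y"
    and eq: "chain_map p q x = e + chain_boundary (Suc p) y"
  shows "\<exists>a w. cs_chain p (cs_subspace X A) a \<and> cs_chain (Suc p) X w \<and> x = a + chain_boundary (Suc p) w"
proof -
  let ?Sd = "\<lambda>n p. singular_subdivision p ^^ n"
  obtain n1 where n1: "\<And>m. n1 \<le> m \<Longrightarrow> \<exists>u v. cs_chain p (cs_subspace X (points X - A)) u \<and>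
      cs_chain p (cs_subspace X B) v \<and> ?Sd m p x = u + v"
    using small_iterated_subdivision[OF X _ BX cover_X x] by blast
  obtain n2 where n2: "\<And>m. n2 \<le> m \<Longrightarrow> \<exists>u v. cs_chain (Suc p) (cs_subspace Y (points Y - {A})) u \<and>
      cs_chain (Suc p) (cs_subspace Y (q ` B)) v \<and> ?Sd m (Suc p) y = u + v"
    using small_iterated_subdivision[OF Y _ qB_Y cover_Y y] by blast
  define n where "n = max n1 n2"
  obtain u1 b1 where u1: "cs_chain p (cs_subspace X (points X - A)) u1" and b1: "cs_chain p (cs_subspace X B) b1"
    and ub1: "?Sd n p x = u1 + b1"
    using n1[of n] by (auto simp: n_def)
  obtain u b where u: "cs_chain (Suc p) (cs_subspace Y (points Y - {A})) u"
    and b: "cs_chain (Suc p) (cs_subspace Y (q ` B)) b" and ub: "?Sd n (Suc p) y = u + b"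
    using n2[of n] by (auto simp: n_def)
  obtain d1 e1 where d1: "cs_chain (Suc p) X d1" and e1: "cs_chain p (cs_subspace X A) e1"
    and sd: "?Sd n p x = x + e1 + chain_boundary (Suc p) d1"
    using singular_subdivision_homologous[OF x dx] by blast
  define u0 where "u0 = chain_map (Suc p) rep u"
  have u0: "cs_chain (Suc p) (cs_subspace X (points X - A)) u0" and qu0: "chain_map (Suc p) q u0 = u"
    using rep_chain[OF u] chain_map_q_rep[OF u] by (simp_all add: u0_def)
  define v where "v = u1 - chain_boundary (Suc p) u0"
  have v: "cs_chain p (cs_subspace X (points X - A)) v"
    unfolding v_def using cs_chain_boundary[OF u0] by (intro cs_chain_diff u1) simp
  have "chain_map p q (?Sd n p x) = ?Sd n p e + chain_boundary (Suc p) (?Sd n (Suc p) y)"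
    using naturality_iterated_subdivision[OF singular_chain_indiscrete[OF x], of n q]
      chain_boundary_iterated_subdivision[OF singular_chain_indiscrete[OF y], of n] eq
      singular_subdivision_power_diff[where n = n and p = p and a = "chain_map p q x" and b = "chain_boundary (Suc p) y"]
    by (simp add: algebra_simps)
  then have "chain_map p q v = ?Sd n p e + chain_boundary (Suc p) b - chain_map p q b1"
    using cs_chain_boundary_chain_map[OF u0, of q] qu0
    by (simp add: v_def chain_map_diff chain_map_add chain_boundary_add ub1 ub algebra_simps)
  moreover have "cs_chain p (cs_subspace Y (q ` B)) (?Sd n p e + chain_boundary (Suc p) b - chain_map p q b1)"
    using cs_chain_boundary[OF b] cs_chain_subspace_mono[OF e _ qB_Y] A_in_qB
    by (intro cs_chain_diff cs_chain_add cs_chain_iterated_subdivision cs_chain_chain_map[OF b1 q_B]) auto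
  ultimately have "cs_chain p (cs_subspace X B) (chain_map p rep (chain_map p q v))"
    using rep_chain_B[OF cs_chain_chain_map[OF v q_off_A]] by simp
  then have vB: "cs_chain p (cs_subspace X B) v"
    by (simp add: chain_map_rep_q[OF v])
  have u0X: "cs_chain (Suc p) X u0"
    by (rule cs_chain_subspace_imp[OF u0]) auto
  have sd': "v + b1 = x + e1 + chain_boundary (Suc p) (d1 - u0)"
    using sd ub1 by (simp add: v_def chain_boundary_diff algebra_simps)
  then have "chain_boundary p (v + b1) = chain_boundary p x + chain_boundary p e1"
    using cs_chain_boundary_boundary[OF cs_chain_diff[OF d1 u0X]] by (simp add: chain_boundary_add)
  then have "cs_chain (p - Suc 0) (cs_subspace X A) (chain_boundary p (v + b1))"
    using cs_chain_add[OF dx cs_chain_boundary[OF e1]] by simp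
  then obtain a2 d2 where a2: "cs_chain p (cs_subspace X A) a2" and d2: "cs_chain (Suc p) (cs_subspace X B) d2"
    and vb: "v + b1 = a2 + chain_boundary (Suc p) d2"
    using deformation_B[OF cs_chain_add[OF vB b1]] by blast
  have "x = (v + b1) - e1 - chain_boundary (Suc p) (d1 - u0)"
    unfolding sd' by simp
  also have "\<dots> = (a2 - e1) + chain_boundary (Suc p) (d2 - (d1 - u0))"
    unfolding vb by (simp add: chain_boundary_diff)
  finally have "x = (a2 - e1) + chain_boundary (Suc p) (d2 - (d1 - u0))" .
  moreover have "cs_chain (Suc p) X (d2 - (d1 - u0))"
    by (intro cs_chain_diff d1 u0X cs_chain_subspace_imp[OF d2 BX])
  ultimately show ?thesis
    using cs_chain_diff[OF a2 e1] by blast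
qed

end

lemma good_pairE:
  assumes "closure_space X" "A \<noteq> {}" "cs_closed X A" "cs_good_pair X A"
  obtains B H where "good_pair X A B H"
proof -
  obtain B r H where B: "cs_nbhd X A B" and r: "cs_deformation_retraction (cs_subspace X B) A r H"
    using assms by (auto simp: cs_good_pair_def)
  have rA: "r x \<in> A" if "x \<in> B" for x
    using r that by (auto simp: cs_deformation_retraction_def cs_retraction_def)
  have "good_pair X A B H"
    using assms B r rA
    by unfold_locales (auto simp: cs_deformation_retraction_def cs_homotopy_def)
  then show thesis
    by (rule that)
qed

section \<open>The augmented complex\<close>

abbreviation aug_chains :: "int \<Rightarrow> 'a closure_space \<Rightarrow> 'a chain set" where
  "aug_chains n X \<equiv> carrier (aug_chain_group n X)"

abbreviation aug_cycles :: "int \<Rightarrow> 'a closure_space \<Rightarrow> 'a chain set" where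
  "aug_cycles n X \<equiv> {c \<in> aug_chains n X. aug_boundary n c = 0}"

lemma aug_chains_nonneg: "c \<in> aug_chains (int p) X \<longleftrightarrow> cs_chain p X c"
  by (simp add: aug_chain_group_def cs_chain_def)

text \<open>In negative degrees the augmented complexes of all spaces agree, so that relative chains
  vanish there.\<close>

lemma aug_chains_neg: "n < 0 \<Longrightarrow> aug_chains n X = aug_chains n Z"
  by (simp add: aug_chain_group_def)

lemma aug_chains_0 [simp]: "0 \<in> aug_chains n X"
  by (simp add: aug_chain_group_def)

lemma aug_chains_add: "c \<in> aug_chains n X \<Longrightarrow> d \<in> aug_chains n X \<Longrightarrow> c + d \<in> aug_chains n X"
  using Poly_Mapping.keys_add[of c d] unfolding aug_chain_group_def carrier_free_Abelian_group_iff by blast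

lemma aug_chains_minus: "c \<in> aug_chains n X \<Longrightarrow> - c \<in> aug_chains n X"
  by (simp add: aug_chain_group_def)

lemma aug_chains_diff: "c \<in> aug_chains n X \<Longrightarrow> d \<in> aug_chains n X \<Longrightarrow> c - d \<in> aug_chains n X"
  using aug_chains_add[of c n X "- d"] aug_chains_minus[of d n X] by simp

text \<open>Writing the augmentation as a linear extension makes it accessible to the rules for
  \<open>frag_extend\<close>.\<close>

lemma frag_extend_const:
  fixes c :: "'a chain"
  shows "frag_extend (\<lambda>_. a) c = frag_cmul (augmentation c) a"
proof -
  have "(\<Sum>i\<in>I. frag_cmul (k i) a) = frag_cmul (sum k I) a" for I and k :: "((nat \<Rightarrow> real) \<Rightarrow> 'a) \<Rightarrow> int"
    by (induction I rule: infinite_finite_induct) (auto simp: frag_cmul_distrib)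
  then show ?thesis
    by (simp add: frag_extend_def augmentation_def)
qed

lemma aug_boundary_nonneg: "aug_boundary (int (Suc p)) c = chain_boundary (Suc p) c"
  unfolding aug_boundary_def nat_int by simp

lemma aug_boundary_zero: "aug_boundary 0 c = frag_extend (\<lambda>_. frag_of empty_simplex) c"
  by (simp add: aug_boundary_def frag_extend_const)

lemma aug_boundary_neg [simp]: "n < 0 \<Longrightarrow> aug_boundary n c = 0"
  by (simp add: aug_boundary_def)

lemma aug_degree_cases:
  obtains (neg) "n < 0" | (zero) "n = 0" | (pos) p where "n = int (Suc p)"
proof -
  have "n = int (Suc (nat (n - 1)))" if "n > 0"
    using that by simp
  then show thesis
    using neg zero pos by (metis linorder_neqE)
qed

lemma aug_boundary_diff: "aug_boundary n (c - d) = aug_boundary n c - aug_boundary n d"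
  by (cases n rule: aug_degree_cases)
    (simp_all only: aug_boundary_nonneg chain_boundary_diff aug_boundary_zero frag_extend_diff aug_boundary_neg diff_self)

lemma aug_boundary_0 [simp]: "aug_boundary n 0 = 0"
  using aug_boundary_diff[of n 0 0] by simp

lemma aug_boundary_minus: "aug_boundary n (- c) = - aug_boundary n c"
  using aug_boundary_diff[of n 0 c] by simp

lemma aug_boundary_add: "aug_boundary n (c + d) = aug_boundary n c + aug_boundary n d"
  using aug_boundary_diff[of n c "- d"] by (simp add: aug_boundary_minus)

lemma aug_boundary_closed:
  assumes "c \<in> aug_chains n X"
  shows "aug_boundary n c \<in> aug_chains (n - 1) X"
proof (cases n rule: aug_degree_cases)
  case zero
  then show ?thesis
    by (auto simp: aug_boundary_def aug_chain_group_def)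
next
  case (pos p)
  have "aug_boundary n c \<in> aug_chains (int p) X"
    using assms unfolding pos aug_boundary_nonneg aug_chains_nonneg by (rule cs_chain_boundary_Suc)
  then show ?thesis
    by (simp add: pos)
qed simp

lemma aug_boundary_boundary:
  assumes "c \<in> aug_chains n X"
  shows "aug_boundary (n - 1) (aug_boundary n c) = 0"
proof (cases n rule: aug_degree_cases)
  case (pos p)
  have c: "cs_chain (Suc p) X c"
    using assms unfolding pos aug_chains_nonneg .
  show ?thesis
  proof (cases p)
    case 0
    have "frag_extend (\<lambda>_. frag_of empty_simplex) (chain_boundary (Suc 0) c) = 0"
      using subset_UNIV
      by (induction c rule: frag_induction)
        (auto simp: chain_boundary_of chain_boundary_diff frag_extend_diff frag_extend_add frag_extend_minus)
    then show ?thesis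
      using pos 0 by (simp add: aug_boundary_zero aug_boundary_nonneg[of 0, simplified])
  next
    case (Suc k)
    have "n - 1 = int (Suc k)"
      by (simp add: pos Suc)
    then have "aug_boundary (n - 1) (aug_boundary n c) = chain_boundary (Suc k) (chain_boundary (Suc (Suc k)) c)"
      by (simp only: pos Suc aug_boundary_nonneg)
    then show ?thesis
      using cs_chain_boundary_boundary[OF c] Suc by simp
  qed
qed simp_all

lemma aug_chain_map_nonneg: "aug_chain_map (int p) f c = chain_map p f c"
  by (simp add: aug_chain_map_def)

lemma aug_chain_map_diff: "aug_chain_map n f (c - d) = aug_chain_map n f c - aug_chain_map n f d"
  by (simp add: aug_chain_map_def chain_map_diff lookup_minus frag_cmul_diff_distrib)

lemma aug_chain_map_0 [simp]: "aug_chain_map n f 0 = 0"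
  by (simp add: aug_chain_map_def)

lemma aug_chain_map_minus: "aug_chain_map n f (- c) = - aug_chain_map n f c"
  using aug_chain_map_diff[of n f 0 c] by simp

lemma aug_chain_map_add: "aug_chain_map n f (c + d) = aug_chain_map n f c + aug_chain_map n f d"
  using aug_chain_map_diff[of n f c "- d"] by (simp add: aug_chain_map_minus)

lemma aug_chain_map_closed:
  assumes f: "cs_continuous X Z f" and c: "c \<in> aug_chains n X"
  shows "aug_chain_map n f c \<in> aug_chains n Z"
proof (cases "n < 0")
  case True
  then show ?thesis
    using c by (auto simp: aug_chain_map_def aug_chain_group_def split: if_splits)
next
  case False
  then obtain p where n: "n = int p"
    by (metis nonneg_int_cases not_less)
  show ?thesis
    using c unfolding n aug_chains_nonneg aug_chain_map_nonneg by (rule cs_chain_chain_map[OF _ f])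
qed

lemma aug_boundary_chain_map:
  assumes c: "c \<in> aug_chains n X"
  shows "aug_boundary n (aug_chain_map n f c) = aug_chain_map (n - 1) f (aug_boundary n c)"
proof (cases n rule: aug_degree_cases)
  case zero
  have "frag_extend (\<lambda>_. frag_of empty_simplex) (chain_map 0 f c) = frag_extend (\<lambda>_. frag_of empty_simplex) c"
    unfolding chain_map_def frag_extend_compose by (simp add: o_def)
  then have "aug_boundary 0 (aug_chain_map 0 f c) = frag_cmul (augmentation c) (frag_of empty_simplex)"
    by (simp add: aug_boundary_zero aug_chain_map_def frag_extend_const)
  then show ?thesis
    by (simp add: zero aug_chain_map_def aug_boundary_def)
next
  case (pos p)
  have "cs_chain (Suc p) X c"
    using c unfolding pos aug_chains_nonneg .
  from cs_chain_boundary_chain_map[OF this, of f]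
  have "aug_boundary n (aug_chain_map n f c) = aug_chain_map (int p) f (aug_boundary n c)"
    unfolding pos aug_boundary_nonneg aug_chain_map_nonneg by simp
  then show ?thesis
    by (simp add: pos)
qed simp

lemma aug_chain_map_id:
  assumes "c \<in> aug_chains n X"
  shows "aug_chain_map n id c = c"
proof (cases "n < 0")
  case True
  then have keys: "Poly_Mapping.keys c \<subseteq> {empty_simplex}"
    using assms by (auto simp: aug_chain_group_def split: if_splits)
  have "Poly_Mapping.lookup (frag_cmul (Poly_Mapping.lookup c empty_simplex) (frag_of empty_simplex)) s = Poly_Mapping.lookup c s" for s
    using keys by (cases "s = empty_simplex") (auto simp: in_keys_iff subset_iff)
  then have "frag_cmul (Poly_Mapping.lookup c empty_simplex) (frag_of empty_simplex) = c"
    by (rule poly_mapping_eqI)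
  then show ?thesis
    using True by (simp add: aug_chain_map_def)
next
  case False
  then obtain p where n: "n = int p"
    by (metis nonneg_int_cases not_less)
  show ?thesis
    using assms cs_chain_map_id[of p X c id] unfolding n aug_chains_nonneg aug_chain_map_nonneg by simp
qed

lemma aug_chains_subspace:
  assumes "S \<subseteq> points X"
  shows "aug_chains n (cs_subspace X S) \<subseteq> aug_chains n X"
proof
  fix c assume c: "c \<in> aug_chains n (cs_subspace X S)"
  show "c \<in> aug_chains n X"
    using aug_chain_map_closed[OF cs_continuous_id_subspace[OF assms] c] aug_chain_map_id[OF c] by simp
qed

lemma aug_boundariesI: "d \<in> aug_chains (n + 1) X \<Longrightarrow> b = aug_boundary (n + 1) d \<Longrightarrow> b \<in> aug_boundaries n X"
  by (simp add: aug_boundaries_def)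

lemma aug_boundariesE:
  assumes "b \<in> aug_boundaries n X"
  obtains d where "d \<in> aug_chains (n + 1) X" "b = aug_boundary (n + 1) d"
  using assms unfolding aug_boundaries_def by (elim imageE) simp

lemma aug_boundaries_0 [simp]: "0 \<in> aug_boundaries n X"
  by (rule aug_boundariesI[of 0]) simp_all

text \<open>The augmented complex of a one-point space is acyclic.  In positive degrees this is the
  classical computation, as the only simplices are the constant ones; in degrees 0 and -1 the augmentation
  is an isomorphism.\<close>

lemma aug_cycles_point:
  fixes P :: "'a closure_space"
  assumes P: "closure_space P" and a: "points P = {a}"
  shows "aug_cycles n P \<subseteq> aug_boundaries n P"
proof
  let ?T = "subtopology (discrete_topology UNIV) {a}"
  have T: "topspace ?T = {a}"
    by simp
  have simplex: "cs_simplex p P f \<longleftrightarrow> singular_simplex p ?T f" for p f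
  proof -
    have "cs_simplex p P (restrict (\<lambda>_. a) (standard_simplex p))"
      unfolding cs_simplex_def
    proof
      show "cs_continuous (cs_of_topology (simplex_top p)) P (restrict (\<lambda>_. a) (standard_simplex p))"
        by (rule cs_continuous_cong_imp[OF closure_space_cs_of_topology _
              cs_continuous_const[OF closure_space_cs_of_topology P, of a]]) (use a in auto)
    qed simp
    moreover have "f = restrict (\<lambda>_. a) (standard_simplex p)" if f: "cs_simplex p P f"
    proof
      fix t
      show "f t = restrict (\<lambda>_. a) (standard_simplex p) t"
        using f cs_continuous_points[of "cs_of_topology (simplex_top p)" P f t] a
        by (auto simp: cs_simplex_def extensional_def)
    qed
    ultimately show ?thesis
      using singular_simplex_singleton[OF T] by metis
  qed
  then have chain: "cs_chain p P c \<longleftrightarrow> singular_chain p ?T c" for p c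
    by (simp add: cs_chain_def singular_chain_def)
  fix c assume "c \<in> aug_cycles n P"
  then have c: "c \<in> aug_chains n P" and dc: "aug_boundary n c = 0"
    by auto
  show "c \<in> aug_boundaries n P"
  proof (cases n rule: aug_degree_cases)
    case neg
    have c_eq: "c = frag_cmul (Poly_Mapping.lookup c empty_simplex) (frag_of empty_simplex)"
      using aug_chain_map_id[OF c] neg by (simp add: aug_chain_map_def)
    show ?thesis
    proof (cases "n = - 1")
      case True
      let ?d = "frag_cmul (Poly_Mapping.lookup c empty_simplex) (frag_of (restrict (\<lambda>_. a) (standard_simplex 0)))"
      have "cs_chain 0 P ?d"
        unfolding chain using singular_chain_singleton[OF T] by blast
      then have "?d \<in> aug_chains (n + 1) P"
        using aug_chains_nonneg[of ?d 0 P] True by simp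
      moreover have "aug_boundary (n + 1) ?d = c"
        using c_eq True by (simp add: aug_boundary_zero frag_extend_cmul)
      ultimately show ?thesis
        by (intro aug_boundariesI[of ?d]) simp_all
    next
      case False
      then have "c = 0"
        using c neg by (simp add: aug_chain_group_def)
      then show ?thesis
        by simp
    qed
  next
    case zero
    then obtain b where b: "c = frag_cmul b (frag_of (restrict (\<lambda>_. a) (standard_simplex 0)))"
      using c aug_chains_nonneg[of c 0 P] chain[of 0 c] singular_chain_singleton[OF T, of 0 c] by auto
    then have "frag_cmul b (frag_of (empty_simplex :: (nat \<Rightarrow> real) \<Rightarrow> 'a)) = 0"
      using dc by (simp add: zero aug_boundary_zero frag_extend_cmul)
    then have "c = 0"
      using b by auto
    then show ?thesis
      by simp
  next
    case (pos p)
    have "singular_relcycle (Suc p) ?T {} c"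
      using c dc unfolding pos aug_chains_nonneg aug_boundary_nonneg chain by (simp add: singular_cycle)
    then have "singular_relboundary (Suc p) ?T {} c"
      using singular_boundary_eq_cycle_singleton[OF T, of "Suc p" c] by simp
    then obtain d where "cs_chain (Suc (Suc p)) P d" "chain_boundary (Suc (Suc p)) d = c"
      unfolding singular_boundary chain by blast
    then have "d \<in> aug_chains (int (Suc (Suc p))) P" "aug_boundary (int (Suc (Suc p))) d = c"
      unfolding aug_chains_nonneg aug_boundary_nonneg by auto
    moreover have "n + 1 = int (Suc (Suc p))"
      by (simp add: pos)
    ultimately show ?thesis
      by (intro aug_boundariesI[of d]) (simp_all only:)
  qed
qed

section \<open>Reduced homology classes\<close>

lemma aug_boundaries_add:
  "b \<in> aug_boundaries n X \<Longrightarrow> c \<in> aug_boundaries n X \<Longrightarrow> b + c \<in> aug_boundaries n X"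
  by (elim aug_boundariesE, rule aug_boundariesI[OF aug_chains_add]) (simp_all add: aug_boundary_add)

lemma aug_boundaries_minus: "b \<in> aug_boundaries n X \<Longrightarrow> - b \<in> aug_boundaries n X"
  by (elim aug_boundariesE, rule aug_boundariesI[OF aug_chains_minus]) (simp_all add: aug_boundary_minus)

lemma aug_boundaries_diff:
  "b \<in> aug_boundaries n X \<Longrightarrow> c \<in> aug_boundaries n X \<Longrightarrow> b - c \<in> aug_boundaries n X"
  using aug_boundaries_add[of b n X "- c"] aug_boundaries_minus[of c n X] by simp

lemma aug_boundaries_subset_cycles: "aug_boundaries n X \<subseteq> aug_cycles n X"
  using aug_boundary_closed[of _ "n + 1" X] aug_boundary_boundary[of _ "n + 1" X]
  by (auto simp: aug_boundaries_def)

lemma aug_boundaries_chain_map: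
  assumes f: "cs_continuous X Z f" and b: "b \<in> aug_boundaries n X"
  shows "aug_chain_map n f b \<in> aug_boundaries n Z"
proof -
  obtain d where d: "d \<in> aug_chains (n + 1) X" and b: "b = aug_boundary (n + 1) d"
    using b by (rule aug_boundariesE)
  show ?thesis
    using aug_boundary_chain_map[OF d, of f] by (intro aug_boundariesI[OF aug_chain_map_closed[OF f d]]) (simp add: b)
qed

lemma aug_cycles_chain_map:
  assumes f: "cs_continuous X Z f" and z: "z \<in> aug_cycles n X"
  shows "aug_chain_map n f z \<in> aug_cycles n Z"
  using z aug_chain_map_closed[OF f, of z n] aug_boundary_chain_map[of z n X f] by simp

lemma aug_boundaries_subspace:
  "S \<subseteq> points X \<Longrightarrow> aug_boundaries n (cs_subspace X S) \<subseteq> aug_boundaries n X"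
  using aug_chains_subspace[of S X "n + 1"] by (auto simp: aug_boundaries_def)

lemma group_aug_chain_group: "group (aug_chain_group n X)"
  by (simp add: aug_chain_group_def)

lemma mult_aug_chain_group [simp]: "x \<otimes>\<^bsub>aug_chain_group n X\<^esub> y = x + y"
  by (simp add: aug_chain_group_def)

lemma one_aug_chain_group [simp]: "\<one>\<^bsub>aug_chain_group n X\<^esub> = 0"
  by (simp add: aug_chain_group_def)

lemma kernel_aug_boundary:
  "kernel (aug_chain_group n X) (aug_chain_group (n - 1) X) (aug_boundary n) = aug_cycles n X"
  by (auto simp: kernel_def)

lemma mult_aug_cycle_group [simp]: "x \<otimes>\<^bsub>aug_cycle_group n X\<^esub> y = x + y"
  by (simp add: aug_cycle_group_def)

lemma one_aug_cycle_group [simp]: "\<one>\<^bsub>aug_cycle_group n X\<^esub> = 0"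
  by (simp add: aug_cycle_group_def)

lemma subgroup_aug_cycles: "subgroup (aug_cycles n X) (aug_chain_group n X)"
proof -
  have "group_hom (aug_chain_group n X) (aug_chain_group (n - 1) X) (aug_boundary n)"
    by (auto simp: group_hom_def group_hom_axioms_def group_aug_chain_group hom_def
        aug_boundary_closed aug_boundary_add)
  then show ?thesis
    using group_hom.subgroup_kernel kernel_aug_boundary by metis
qed

lemma carrier_aug_cycle_group: "carrier (aug_cycle_group n X) = aug_cycles n X"
  unfolding aug_cycle_group_def kernel_aug_boundary
  by (rule subgroup.carrier_subgroup_generated_subgroup[OF subgroup_aug_cycles])

lemma comm_group_aug_cycle_group: "comm_group (aug_cycle_group n X)"
  unfolding aug_cycle_group_def aug_chain_group_def
  by (intro group.abelian_subgroup_generated abelian_free_Abelian_group) simp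

lemma normal_aug_boundaries: "aug_boundaries n X \<lhd> aug_cycle_group n X"
proof -
  interpret comm_group "aug_cycle_group n X"
    by (rule comm_group_aug_cycle_group)
  have "subgroup (aug_boundaries n X) (aug_cycle_group n X)"
  proof
    fix b assume b: "b \<in> aug_boundaries n X"
    then have "b \<in> carrier (aug_cycle_group n X)" "- b \<in> carrier (aug_cycle_group n X)"
      using aug_boundaries_minus aug_boundaries_subset_cycles carrier_aug_cycle_group by blast+
    then have "inv\<^bsub>aug_cycle_group n X\<^esub> b = - b"
      by (intro inv_equality) simp_all
    then show "inv\<^bsub>aug_cycle_group n X\<^esub> b \<in> aug_boundaries n X"
      by (simp add: b aug_boundaries_minus)
  qed (use aug_boundaries_subset_cycles in \<open>auto simp: carrier_aug_cycle_group aug_boundaries_add\<close>)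
  then show ?thesis
    by (rule subgroup_imp_normal)
qed

definition hclass :: "int \<Rightarrow> 'a closure_space \<Rightarrow> 'a chain \<Rightarrow> 'a chain set" where
  "hclass n X z = aug_boundaries n X #>\<^bsub>aug_cycle_group n X\<^esub> z"

lemma mem_hclass: "w \<in> hclass n X z \<longleftrightarrow> w - z \<in> aug_boundaries n X"
proof -
  have "w \<in> hclass n X z \<longleftrightarrow> (\<exists>b\<in>aug_boundaries n X. w = b + z)"
    by (simp add: hclass_def r_coset_def)
  then show ?thesis
    by (metis add_diff_cancel_right' diff_add_cancel)
qed

lemma hclass_self: "z \<in> hclass n X z"
  by (simp add: mem_hclass)

lemma hclass_eq_iff: "hclass n X z = hclass n X w \<longleftrightarrow> z - w \<in> aug_boundaries n X"
proof
  assume "hclass n X z = hclass n X w"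
  then show "z - w \<in> aug_boundaries n X"
    using hclass_self[of z n X] by (simp add: mem_hclass)
next
  assume zw: "z - w \<in> aug_boundaries n X"
  have "v - z \<in> aug_boundaries n X \<longleftrightarrow> v - w \<in> aug_boundaries n X" for v
    using aug_boundaries_add[of "v - z" n X "z - w"] aug_boundaries_diff[of "v - w" n X "z - w"] zw by auto
  then show "hclass n X z = hclass n X w"
    by (auto simp: mem_hclass)
qed

lemma group_reduced_homology: "group (cs_reduced_homology n X)"
  unfolding cs_reduced_homology_def by (rule normal.factorgroup_is_group[OF normal_aug_boundaries])

lemma carrier_reduced_homology: "carrier (cs_reduced_homology n X) = hclass n X ` aug_cycles n X"
  by (simp add: cs_reduced_homology_def carrier_FactGroup carrier_aug_cycle_group hclass_def)

lemma mult_reduced_homology: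
  "z \<in> aug_cycles n X \<Longrightarrow> w \<in> aug_cycles n X \<Longrightarrow>
   hclass n X z \<otimes>\<^bsub>cs_reduced_homology n X\<^esub> hclass n X w = hclass n X (z + w)"
  using normal.rcos_sum[OF normal_aug_boundaries, of z n X w]
  by (simp add: cs_reduced_homology_def hclass_def carrier_aug_cycle_group)

lemma hclass_eq_one_iff: "hclass n X z = \<one>\<^bsub>cs_reduced_homology n X\<^esub> \<longleftrightarrow> z \<in> aug_boundaries n X"
proof -
  have "\<one>\<^bsub>cs_reduced_homology n X\<^esub> = hclass n X 0"
    by (auto simp: cs_reduced_homology_def mem_hclass)
  then show ?thesis
    by (simp add: hclass_eq_iff)
qed

lemma aug_cycles_add: "z \<in> aug_cycles n X \<Longrightarrow> w \<in> aug_cycles n X \<Longrightarrow> z + w \<in> aug_cycles n X"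
  by (simp add: aug_chains_add aug_boundary_add)

lemma group_hom_reduced_homologyI:
  assumes h: "\<And>z. z \<in> aug_cycles n X \<Longrightarrow> h (hclass n X z) = hclass m Z (g z)"
    and g: "\<And>z. z \<in> aug_cycles n X \<Longrightarrow> g z \<in> aug_cycles m Z"
    and add: "\<And>z w. z \<in> aug_cycles n X \<Longrightarrow> w \<in> aug_cycles n X \<Longrightarrow>
      g (z + w) - (g z + g w) \<in> aug_boundaries m Z"
  shows "group_hom (cs_reduced_homology n X) (cs_reduced_homology m Z) h"
proof -
  have "h \<in> hom (cs_reduced_homology n X) (cs_reduced_homology m Z)"
  proof (rule homI)
    fix K assume "K \<in> carrier (cs_reduced_homology n X)"
    then obtain z where z: "z \<in> aug_cycles n X" "K = hclass n X z"
      unfolding carrier_reduced_homology by blast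
    then show "h K \<in> carrier (cs_reduced_homology m Z)"
      unfolding carrier_reduced_homology using h g by blast
    fix L assume "L \<in> carrier (cs_reduced_homology n X)"
    then obtain w where w: "w \<in> aug_cycles n X" "L = hclass n X w"
      unfolding carrier_reduced_homology by blast
    show "h (K \<otimes>\<^bsub>cs_reduced_homology n X\<^esub> L) = h K \<otimes>\<^bsub>cs_reduced_homology m Z\<^esub> h L"
      unfolding z(2) w(2) mult_reduced_homology[OF z(1) w(1)] h[OF z(1)] h[OF w(1)]
        h[OF aug_cycles_add[OF z(1) w(1)]] mult_reduced_homology[OF g[OF z(1)] g[OF w(1)]] hclass_eq_iff
      by (rule add[OF z(1) w(1)])
  qed
  then show ?thesis
    by (simp add: group_hom_def group_hom_axioms_def group_reduced_homology)
qed

lemma induced_hclass: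
  assumes f: "cs_continuous X Z f"
  shows "cs_reduced_hom_induced n Z f (hclass n X z) = hclass n Z (aug_chain_map n f z)"
proof -
  have eq: "hclass n Z (aug_chain_map n f w) = hclass n Z (aug_chain_map n f z)" if "w \<in> hclass n X z" for w
    using aug_boundaries_chain_map[OF f, of "w - z" n] that
    by (simp add: mem_hclass hclass_eq_iff aug_chain_map_diff)
  have "cs_reduced_hom_induced n Z f (hclass n X z) = (\<Union>w\<in>hclass n X z. hclass n Z (aug_chain_map n f w))"
    unfolding cs_reduced_hom_induced_def hclass_def by (rule refl)
  also have "\<dots> = (\<Union>w\<in>hclass n X z. hclass n Z (aug_chain_map n f z))"
    by (rule SUP_cong[OF refl eq])
  also have "\<dots> = hclass n Z (aug_chain_map n f z)"
    using hclass_self[of z n X] by blast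
  finally show ?thesis .
qed

lemma group_hom_induced:
  assumes f: "cs_continuous X Z f"
  shows "group_hom (cs_reduced_homology n X) (cs_reduced_homology n Z) (cs_reduced_hom_induced n Z f)"
proof (rule group_hom_reduced_homologyI[where g = "aug_chain_map n f"])
  show "aug_chain_map n f z \<in> aug_cycles n Z" if "z \<in> aug_cycles n X" for z
    using that by (rule aug_cycles_chain_map[OF f])
qed (simp_all add: induced_hclass[OF f] aug_chain_map_add)

text \<open>Maps of homology groups that are given on cycles reduce exactness to a statement about
  cycles.\<close>

lemma exact_at_reduced_homologyI:
  assumes f: "group_hom (cs_reduced_homology k X) (cs_reduced_homology m Y) f"
    and g: "group_hom (cs_reduced_homology m Y) (cs_reduced_homology n Z) g"
    and f': "\<And>z. z \<in> aug_cycles k X \<Longrightarrow> f (hclass k X z) = hclass m Y (f' z)"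
    and g': "\<And>z. z \<in> aug_cycles m Y \<Longrightarrow> g (hclass m Y z) = hclass n Z (g' z)"
    and ex: "\<And>z. z \<in> aug_cycles m Y \<Longrightarrow>
      g' z \<in> aug_boundaries n Z \<longleftrightarrow> (\<exists>w \<in> aug_cycles k X. z - f' w \<in> aug_boundaries m Y)"
  shows "exact_at (cs_reduced_homology k X) f (cs_reduced_homology m Y) g (cs_reduced_homology n Z)"
proof -
  have in_image: "hclass m Y z \<in> f ` carrier (cs_reduced_homology k X) \<longleftrightarrow>
      (\<exists>w \<in> aug_cycles k X. z - f' w \<in> aug_boundaries m Y)" for z
    unfolding carrier_reduced_homology image_image hclass_eq_iff[symmetric]
    using f' by (auto simp: image_iff)
  have kernel: "g (hclass m Y z) = \<one>\<^bsub>cs_reduced_homology n Z\<^esub> \<longleftrightarrow>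
      hclass m Y z \<in> f ` carrier (cs_reduced_homology k X)" if "z \<in> aug_cycles m Y" for z
    unfolding in_image g'[OF that] hclass_eq_one_iff by (rule ex[OF that])
  have "f ` carrier (cs_reduced_homology k X) = kernel (cs_reduced_homology m Y) (cs_reduced_homology n Z) g"
  proof (intro equalityI subsetI)
    fix K assume K: "K \<in> f ` carrier (cs_reduced_homology k X)"
    then have "K \<in> carrier (cs_reduced_homology m Y)"
      using group_hom.hom_closed[OF f] by (elim imageE) simp
    moreover from this obtain z where "z \<in> aug_cycles m Y" "K = hclass m Y z"
      unfolding carrier_reduced_homology by (rule imageE)
    then have "g K = \<one>\<^bsub>cs_reduced_homology n Z\<^esub>"
      using K kernel by simp
    ultimately show "K \<in> kernel (cs_reduced_homology m Y) (cs_reduced_homology n Z) g"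
      by (simp add: kernel_def)
  next
    fix K assume "K \<in> kernel (cs_reduced_homology m Y) (cs_reduced_homology n Z) g"
    then have K: "K \<in> carrier (cs_reduced_homology m Y)" "g K = \<one>\<^bsub>cs_reduced_homology n Z\<^esub>"
      by (simp_all add: kernel_def)
    from K(1) obtain z where "z \<in> aug_cycles m Y" "K = hclass m Y z"
      unfolding carrier_reduced_homology by (rule imageE)
    then show "K \<in> f ` carrier (cs_reduced_homology k X)"
      using K(2) kernel by simp
  qed
  with f g show ?thesis
    by (simp add: exact_at_def)
qed

section \<open>The connecting homomorphism and exactness\<close>

context good_pair
begin

abbreviation XA :: "'a closure_space" where "XA \<equiv> cs_subspace X A"
abbreviation pt :: "'a set closure_space" where "pt \<equiv> cs_subspace Y {A}"

lemma aug_cycles_pt: "aug_cycles n pt \<subseteq> aug_boundaries n pt"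
  by (rule aug_cycles_point[OF closure_space_subspace[OF Y A_in_Y]]) simp

lemma aug_chains_XA: "aug_chains n XA \<subseteq> aug_chains n X"
  by (rule aug_chains_subspace[OF AX])

lemma aug_chains_pt: "aug_chains n pt \<subseteq> aug_chains n Y"
  by (rule aug_chains_subspace[OF A_in_Y])

text \<open>The chain \<open>x\<close> is a relative cycle of \<open>(X, A)\<close> whose image in \<open>(Y, *)\<close> is homologous to the
  cycle \<open>z\<close>.\<close>

definition lifts :: "int \<Rightarrow> 'a set chain \<Rightarrow> 'a chain \<Rightarrow> bool" where
  "lifts n z x \<longleftrightarrow> z \<in> aug_cycles n Y \<and> x \<in> aug_chains n X \<and> aug_boundary n x \<in> aug_chains (n - 1) XA \<and>
    (\<exists>e\<in>aug_chains n pt. \<exists>b\<in>aug_boundaries n Y. aug_chain_map n q x = z + e + b)"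

text \<open>In degree 0 both sides hold: the augmentation lands in a group that does not depend on the
  space, and the unaugmented boundary is zero.\<close>

lemma relative_condition_nonneg:
  "aug_boundary (int p) x \<in> aug_chains (int p - 1) Z \<longleftrightarrow> cs_chain (p - Suc 0) Z (chain_boundary p x)"
proof (cases p)
  case 0
  then show ?thesis
    by (auto simp: aug_boundary_def aug_chain_group_def chain_boundary_def)
next
  case (Suc k)
  have "int p - 1 = int k"
    by (simp add: Suc)
  then show ?thesis
    unfolding Suc by (simp only: aug_boundary_nonneg aug_chains_nonneg diff_Suc_Suc diff_zero)
qed

lemma lifts_exists:
  assumes z: "z \<in> aug_cycles n Y"
  shows "\<exists>x. lifts n z x"
proof (cases "n < 0")
  case True
  then have "z \<in> aug_chains n pt"
    using z aug_chains_neg[of n Y pt] by simp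
  then have "lifts n z 0"
    using z unfolding lifts_def
    by (intro conjI bexI[of _ "- z"] bexI[of _ 0]) (simp_all add: aug_chains_minus)
  then show ?thesis
    by blast
next
  case False
  then obtain p where n: "n = int p"
    by (metis nonneg_int_cases not_less)
  have zc: "cs_chain p Y z"
    using z unfolding n mem_Collect_eq aug_chains_nonneg by (rule conjunct1)
  have "cs_chain (p - Suc 0) pt (chain_boundary p z)"
    using relative_condition_nonneg[of p z pt] z unfolding n by simp
  then obtain x e y where x: "cs_chain p X x" and dx: "cs_chain (p - Suc 0) XA (chain_boundary p x)"
    and e: "cs_chain p pt e" and y: "cs_chain (Suc p) Y y"
    and eq: "chain_map p q x = z + e + chain_boundary (Suc p) y"
    using lift_relative_cycle[OF zc] by blast
  have xa: "x \<in> aug_chains n X"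
    using x unfolding n aug_chains_nonneg .
  have Suc: "int p + 1 = int (Suc p)"
    by simp
  have "chain_boundary (Suc p) y \<in> aug_boundaries n Y"
    unfolding n by (rule aug_boundariesI[of y]) (use y in \<open>simp_all only: Suc aug_chains_nonneg aug_boundary_nonneg\<close>)
  moreover have "e \<in> aug_chains n pt"
    using e unfolding n aug_chains_nonneg .
  moreover have "aug_chain_map n q x = z + e + chain_boundary (Suc p) y"
    using eq unfolding n aug_chain_map_nonneg .
  moreover have "aug_boundary n x \<in> aug_chains (n - 1) XA"
    using relative_condition_nonneg[of p x XA] xa dx unfolding n by simp
  ultimately have "lifts n z x"
    using z xa unfolding lifts_def by blast
  then show ?thesis
    by blast
qed

lemma relative_boundary_aug:
  assumes x: "x \<in> aug_chains n X" and dx: "aug_boundary n x \<in> aug_chains (n - 1) XA"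
    and e: "e \<in> aug_chains n pt" and b: "b \<in> aug_boundaries n Y"
    and eq: "aug_chain_map n q x = e + b"
  shows "\<exists>a\<in>aug_chains n XA. \<exists>w\<in>aug_chains (n + 1) X. x = a + aug_boundary (n + 1) w"
proof (cases "n < 0")
  case True
  then have "x \<in> aug_chains n XA"
    using x aug_chains_neg[of n X XA] by simp
  then show ?thesis
    by (intro bexI[of _ x] bexI[of _ 0]) simp_all
next
  case False
  then obtain p where n: "n = int p"
    by (metis nonneg_int_cases not_less)
  have Suc: "int p + 1 = int (Suc p)"
    by simp
  obtain y where y: "y \<in> aug_chains (n + 1) Y" "b = aug_boundary (n + 1) y"
    using b by (rule aug_boundariesE)
  have "cs_chain p X x" "cs_chain p pt e"
    using x e unfolding n aug_chains_nonneg .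
  moreover have "cs_chain (p - Suc 0) XA (chain_boundary p x)"
    using relative_condition_nonneg[of p x XA] x dx unfolding n by simp
  moreover have "cs_chain (Suc p) Y y" "chain_map p q x = e + chain_boundary (Suc p) y"
    using y eq unfolding n Suc aug_chains_nonneg aug_boundary_nonneg aug_chain_map_nonneg by simp_all
  ultimately obtain a w where "cs_chain p XA a" "cs_chain (Suc p) X w" "x = a + chain_boundary (Suc p) w"
    using relative_boundary_if_quotient_boundary by blast
  then show ?thesis
    unfolding n Suc
    by (intro bexI[of _ a] bexI[of _ w]) (simp_all only: aug_chains_nonneg aug_boundary_nonneg)
qed

text \<open>The difference of two lifts of homologous cycles is a relative cycle whose image is a boundary in
  \<open>(Y, *)\<close>.  By injectivity it differs by a boundary from a chain \<open>a\<close> of \<open>A\<close>, so that the boundaries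
  of the two lifts differ by the boundary of \<open>a\<close>.\<close>

lemma lifts_boundary_unique:
  assumes x: "lifts n z x" and x': "lifts n z' x'" and zz': "z - z' \<in> aug_boundaries n Y"
  shows "aug_boundary n x - aug_boundary n x' \<in> aug_boundaries (n - 1) XA"
proof -
  obtain e b where e: "e \<in> aug_chains n pt" and b: "b \<in> aug_boundaries n Y"
    and qx: "aug_chain_map n q x = z + e + b"
    using x unfolding lifts_def by blast
  obtain e' b' where e': "e' \<in> aug_chains n pt" and b': "b' \<in> aug_boundaries n Y"
    and qx': "aug_chain_map n q x' = z' + e' + b'"
    using x' unfolding lifts_def by blast
  have "x - x' \<in> aug_chains n X"
    using x x' by (intro aug_chains_diff) (simp_all add: lifts_def)
  moreover have "aug_boundary n (x - x') \<in> aug_chains (n - 1) XA"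
    using x x' unfolding aug_boundary_diff by (intro aug_chains_diff) (simp_all add: lifts_def)
  moreover have "e - e' \<in> aug_chains n pt"
    using e e' by (rule aug_chains_diff)
  moreover have "(z - z') + (b - b') \<in> aug_boundaries n Y"
    by (intro aug_boundaries_add aug_boundaries_diff zz' b b')
  moreover have "aug_chain_map n q (x - x') = (e - e') + ((z - z') + (b - b'))"
    by (simp add: aug_chain_map_diff qx qx')
  ultimately obtain a w where a: "a \<in> aug_chains n XA" and w: "w \<in> aug_chains (n + 1) X"
    and xx': "x - x' = a + aug_boundary (n + 1) w"
    using relative_boundary_aug by blast
  have "aug_boundary n (x - x') = aug_boundary n a"
    using aug_boundary_boundary[OF w] by (simp add: xx' aug_boundary_add)
  then show ?thesis
    using a by (intro aug_boundariesI[of a]) (simp_all add: aug_boundary_diff)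
qed

lemma lifts_add:
  assumes x: "lifts n z x" and x': "lifts n z' x'"
  shows "lifts n (z + z') (x + x')"
proof -
  obtain e b where e: "e \<in> aug_chains n pt" and b: "b \<in> aug_boundaries n Y"
    and qx: "aug_chain_map n q x = z + e + b"
    using x unfolding lifts_def by blast
  obtain e' b' where e': "e' \<in> aug_chains n pt" and b': "b' \<in> aug_boundaries n Y"
    and qx': "aug_chain_map n q x' = z' + e' + b'"
    using x' unfolding lifts_def by blast
  have "z + z' \<in> aug_cycles n Y"
    using x x' aug_cycles_add[of z n Y z'] unfolding lifts_def by blast
  moreover have "x + x' \<in> aug_chains n X"
    using x x' by (intro aug_chains_add) (simp_all add: lifts_def)
  moreover have "aug_boundary n (x + x') \<in> aug_chains (n - 1) XA"
    using x x' unfolding aug_boundary_add by (intro aug_chains_add) (simp_all add: lifts_def)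
  moreover have "aug_chain_map n q (x + x') = (z + z') + (e + e') + (b + b')"
    by (simp add: aug_chain_map_add qx qx')
  ultimately show ?thesis
    unfolding lifts_def using aug_chains_add[OF e e'] aug_boundaries_add[OF b b'] by blast
qed

lemma lifts_boundary_cycle: "lifts n z x \<Longrightarrow> aug_boundary n x \<in> aug_cycles (n - 1) XA"
  using aug_boundary_boundary[of x n X] by (simp add: lifts_def)

definition lift :: "int \<Rightarrow> 'a set chain \<Rightarrow> 'a chain" where
  "lift n z = (SOME x. lifts n z x)"

lemma lifts_lift: "z \<in> aug_cycles n Y \<Longrightarrow> lifts n z (lift n z)"
  unfolding lift_def by (rule someI_ex[OF lifts_exists])

text \<open>A class is a set of cycles of which one is chosen; by \<open>lifts_boundary_unique\<close> neither this choice
  nor that of the lift affects the value.\<close>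

definition connecting :: "int \<Rightarrow> 'a set chain set \<Rightarrow> 'a chain set" where
  "connecting n K = hclass (n - 1) XA (aug_boundary n (lift n (SOME z. z \<in> K \<and> z \<in> aug_cycles n Y)))"

lemma connecting_hclass:
  assumes z: "z \<in> aug_cycles n Y"
  shows "connecting n (hclass n Y z) = hclass (n - 1) XA (aug_boundary n (lift n z))"
proof -
  let ?w = "SOME w. w \<in> hclass n Y z \<and> w \<in> aug_cycles n Y"
  have w: "?w \<in> hclass n Y z \<and> ?w \<in> aug_cycles n Y"
    by (rule someI[of _ z]) (use z hclass_self in blast)
  have "aug_boundary n (lift n ?w) - aug_boundary n (lift n z) \<in> aug_boundaries (n - 1) XA"
    using w by (intro lifts_boundary_unique[OF lifts_lift lifts_lift[OF z]]) (simp_all add: mem_hclass)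
  then show ?thesis
    unfolding connecting_def hclass_eq_iff .
qed

lemma group_hom_connecting:
  "group_hom (cs_reduced_homology n Y) (cs_reduced_homology (n - 1) XA) (connecting n)"
proof (rule group_hom_reduced_homologyI[where g = "\<lambda>z. aug_boundary n (lift n z)"])
  fix z assume z: "z \<in> aug_cycles n Y"
  show "connecting n (hclass n Y z) = hclass (n - 1) XA (aug_boundary n (lift n z))"
    by (rule connecting_hclass[OF z])
  show "aug_boundary n (lift n z) \<in> aug_cycles (n - 1) XA"
    by (rule lifts_boundary_cycle[OF lifts_lift[OF z]])
  fix w assume w: "w \<in> aug_cycles n Y"
  have "aug_boundary n (lift n (z + w)) - aug_boundary n (lift n z + lift n w) \<in> aug_boundaries (n - 1) XA"
    by (rule lifts_boundary_unique[OF lifts_lift[OF aug_cycles_add[OF z w]]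
          lifts_add[OF lifts_lift[OF z] lifts_lift[OF w]]]) simp
  then show "aug_boundary n (lift n (z + w)) - (aug_boundary n (lift n z) + aug_boundary n (lift n w))
      \<in> aug_boundaries (n - 1) XA"
    by (simp only: aug_boundary_add)
qed

lemma inclusion_hclass: "z \<in> aug_cycles n XA \<Longrightarrow> cs_reduced_hom_induced n X id (hclass n XA z) = hclass n X z"
  using aug_chain_map_id[of z n XA] by (simp add: induced_hclass[OF cs_continuous_id_subspace[OF AX]])

lemma group_hom_inclusion:
  "group_hom (cs_reduced_homology n XA) (cs_reduced_homology n X) (cs_reduced_hom_induced n X id)"
  by (rule group_hom_induced[OF cs_continuous_id_subspace[OF AX]])

text \<open>A cycle of \<open>X\<close> whose image is a boundary is, by injectivity, homologous to a cycle of \<open>A\<close>; conversely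
  cycles of \<open>A\<close> are mapped to cycles of a point.\<close>

lemma exact_at_X:
  "exact_at (cs_reduced_homology n XA) (cs_reduced_hom_induced n X id) (cs_reduced_homology n X)
    (cs_reduced_hom_induced n Y q) (cs_reduced_homology n Y)"
proof (rule exact_at_reduced_homologyI[OF group_hom_inclusion group_hom_induced[OF q_continuous]
      inclusion_hclass induced_hclass[OF q_continuous]])
  fix z assume z: "z \<in> aug_cycles n X"
  show "aug_chain_map n q z \<in> aug_boundaries n Y \<longleftrightarrow> (\<exists>w \<in> aug_cycles n XA. z - w \<in> aug_boundaries n X)"
  proof
    assume "aug_chain_map n q z \<in> aug_boundaries n Y"
    then obtain a w where a: "a \<in> aug_chains n XA" and w: "w \<in> aug_chains (n + 1) X"
      and zaw: "z = a + aug_boundary (n + 1) w"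
      using relative_boundary_aug[of z n 0 "aug_chain_map n q z"] z by auto
    have "aug_boundary n a = 0"
      using z aug_boundary_boundary[OF w] by (simp add: zaw aug_boundary_add)
    moreover have "z - a \<in> aug_boundaries n X"
      using w by (rule aug_boundariesI) (simp add: zaw)
    ultimately show "\<exists>w \<in> aug_cycles n XA. z - w \<in> aug_boundaries n X"
      using a by blast
  next
    assume "\<exists>w \<in> aug_cycles n XA. z - w \<in> aug_boundaries n X"
    then obtain w where w: "w \<in> aug_cycles n XA" and zw: "z - w \<in> aug_boundaries n X"
      by blast
    have qw: "aug_chain_map n q w \<in> aug_boundaries n Y"
      using aug_cycles_chain_map[OF q_A w] aug_cycles_pt aug_boundaries_subspace[OF A_in_Y] by blast
    then show "aug_chain_map n q z \<in> aug_boundaries n Y"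
      using aug_boundaries_add[OF aug_boundaries_chain_map[OF q_continuous zw] qw] by (simp add: aug_chain_map_diff)
  qed
qed

text \<open>If the boundary of a lift is also the boundary of a chain \<open>a\<close> of \<open>A\<close>, subtracting \<open>a\<close> closes the lift up to an
  absolute cycle; its image differs from the given cycle by a boundary and a cycle of the point.\<close>

lemma exact_at_quotient:
  "exact_at (cs_reduced_homology n X) (cs_reduced_hom_induced n Y q) (cs_reduced_homology n Y)
    (connecting n) (cs_reduced_homology (n - 1) XA)"
proof (rule exact_at_reduced_homologyI[OF group_hom_induced[OF q_continuous] group_hom_connecting
      induced_hclass[OF q_continuous] connecting_hclass])
  fix z assume z: "z \<in> aug_cycles n Y"
  let ?x = "lift n z"
  have x: "lifts n z ?x"
    by (rule lifts_lift[OF z])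
  show "aug_boundary n ?x \<in> aug_boundaries (n - 1) XA \<longleftrightarrow>
      (\<exists>v \<in> aug_cycles n X. z - aug_chain_map n q v \<in> aug_boundaries n Y)"
  proof
    assume "aug_boundary n ?x \<in> aug_boundaries (n - 1) XA"
    then obtain a where a: "a \<in> aug_chains n XA" and da: "aug_boundary n ?x = aug_boundary n a"
      by (rule aug_boundariesE) simp
    obtain e b where e: "e \<in> aug_chains n pt" and b: "b \<in> aug_boundaries n Y"
      and qx: "aug_chain_map n q ?x = z + e + b"
      using x unfolding lifts_def by blast
    have v: "?x - a \<in> aug_cycles n X"
      using x a aug_chains_XA da by (auto simp: lifts_def aug_boundary_diff intro!: aug_chains_diff)
    define p where "p = e - aug_chain_map n q a"
    have qv: "aug_chain_map n q (?x - a) = z + p + b"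
      by (simp add: aug_chain_map_diff qx p_def)
    have "aug_boundary n b = 0"
      using b aug_boundaries_subset_cycles by blast
    then have "aug_boundary n p = aug_boundary n (aug_chain_map n q (?x - a)) - aug_boundary n z"
      by (simp add: qv aug_boundary_add)
    also have "\<dots> = 0"
      using z aug_cycles_chain_map[OF q_continuous v] by simp
    finally have "p \<in> aug_cycles n pt"
      using aug_chains_diff[OF e aug_chain_map_closed[OF q_A a]] by (simp add: p_def)
    then have "p \<in> aug_boundaries n Y"
      using aug_cycles_pt aug_boundaries_subspace[OF A_in_Y] by blast
    then have "z - aug_chain_map n q (?x - a) \<in> aug_boundaries n Y"
      using aug_boundaries_minus[OF aug_boundaries_add[OF _ b]] by (simp add: qv)
    then show "\<exists>v \<in> aug_cycles n X. z - aug_chain_map n q v \<in> aug_boundaries n Y"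
      using v by blast
  next
    assume "\<exists>v \<in> aug_cycles n X. z - aug_chain_map n q v \<in> aug_boundaries n Y"
    then obtain v where v: "v \<in> aug_cycles n X" and zv: "z - aug_chain_map n q v \<in> aug_boundaries n Y"
      by blast
    have "lifts n z v"
      using z v aug_boundaries_minus[OF zv] unfolding lifts_def
      by (intro conjI bexI[of _ 0] bexI[of _ "- (z - aug_chain_map n q v)"]) simp_all
    then have "aug_boundary n ?x - aug_boundary n v \<in> aug_boundaries (n - 1) XA"
      by (rule lifts_boundary_unique[OF x]) simp
    then show "aug_boundary n ?x \<in> aug_boundaries (n - 1) XA"
      using v by simp
  qed
qed

text \<open>If a cycle of \<open>A\<close> is the boundary of \<open>y\<close> in \<open>X\<close>, a chain of the point closes the image of \<open>y\<close>
  up to a cycle, and \<open>y\<close> lifts this cycle.\<close>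

lemma exact_at_A:
  "exact_at (cs_reduced_homology n Y) (connecting n) (cs_reduced_homology (n - 1) XA)
    (cs_reduced_hom_induced (n - 1) X id) (cs_reduced_homology (n - 1) X)"
proof (rule exact_at_reduced_homologyI[OF group_hom_connecting group_hom_inclusion connecting_hclass inclusion_hclass])
  fix a assume a: "a \<in> aug_cycles (n - 1) XA"
  show "a \<in> aug_boundaries (n - 1) X \<longleftrightarrow>
      (\<exists>z \<in> aug_cycles n Y. a - aug_boundary n (lift n z) \<in> aug_boundaries (n - 1) XA)"
  proof
    assume "a \<in> aug_boundaries (n - 1) X"
    then obtain y where y: "y \<in> aug_chains n X" and ay: "a = aug_boundary n y"
      by (rule aug_boundariesE) simp
    have "aug_chain_map (n - 1) q a \<in> aug_boundaries (n - 1) pt"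
      using aug_cycles_chain_map[OF q_A a] aug_cycles_pt by blast
    then obtain p where p: "p \<in> aug_chains n pt" and qa: "aug_chain_map (n - 1) q a = aug_boundary n p"
      by (rule aug_boundariesE) simp
    define z where "z = aug_chain_map n q y - p"
    have "aug_boundary n z = 0"
      using aug_boundary_chain_map[OF y, of q] qa by (simp add: z_def aug_boundary_diff ay)
    moreover have "z \<in> aug_chains n Y"
      unfolding z_def using p aug_chains_pt by (intro aug_chains_diff aug_chain_map_closed[OF q_continuous y]) blast
    ultimately have z: "z \<in> aug_cycles n Y"
      by simp
    have "aug_boundary n y \<in> aug_chains (n - 1) XA"
      using a ay by simp
    then have "lifts n z y"
      using z y p unfolding lifts_def
      by (intro conjI bexI[of _ p] bexI[of _ 0]) (simp_all add: z_def)
    then have "a - aug_boundary n (lift n z) \<in> aug_boundaries (n - 1) XA"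
      unfolding ay by (rule lifts_boundary_unique[OF _ lifts_lift[OF z]]) simp
    then show "\<exists>z \<in> aug_cycles n Y. a - aug_boundary n (lift n z) \<in> aug_boundaries (n - 1) XA"
      using z by blast
  next
    assume "\<exists>z \<in> aug_cycles n Y. a - aug_boundary n (lift n z) \<in> aug_boundaries (n - 1) XA"
    then obtain z where z: "z \<in> aug_cycles n Y" and az: "a - aug_boundary n (lift n z) \<in> aug_boundaries (n - 1) XA"
      by blast
    have "lift n z \<in> aug_chains n X"
      using lifts_lift[OF z] by (simp add: lifts_def)
    then have "aug_boundary n (lift n z) \<in> aug_boundaries (n - 1) X"
      by (intro aug_boundariesI[of "lift n z"]) simp_all
    moreover have "a - aug_boundary n (lift n z) \<in> aug_boundaries (n - 1) X"
      using az aug_boundaries_subspace[OF AX] by blast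
    ultimately have "a - aug_boundary n (lift n z) + aug_boundary n (lift n z) \<in> aug_boundaries (n - 1) X"
      by (intro aug_boundaries_add)
    then show "a \<in> aug_boundaries (n - 1) X"
      by simp
  qed
qed

end

theorem theorem4p9:
  fixes X :: "'a closure_space" and A :: "'a set"
  assumes "closure_space X"
    and "A \<noteq> {}" and "cs_closed X A"
    and "cs_good_pair X A"
  shows "\<exists>\<delta> :: int \<Rightarrow> 'a set chain set \<Rightarrow> 'a chain set. \<forall>n.
     exact_at (cs_reduced_homology n (cs_subspace X A)) (cs_reduced_hom_induced n X id)
              (cs_reduced_homology n X)
              (cs_reduced_hom_induced n (cs_quotient X A) (collapse A))
              (cs_reduced_homology n (cs_quotient X A)) \<and>
     exact_at (cs_reduced_homology n X)
              (cs_reduced_hom_induced n (cs_quotient X A) (collapse A))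
              (cs_reduced_homology n (cs_quotient X A)) (\<delta> n)
              (cs_reduced_homology (n - 1) (cs_subspace X A)) \<and>
     exact_at (cs_reduced_homology n (cs_quotient X A)) (\<delta> n)
              (cs_reduced_homology (n - 1) (cs_subspace X A))
              (cs_reduced_hom_induced (n - 1) X id)
              (cs_reduced_homology (n - 1) X)"
proof -
  obtain B H where "good_pair X A B H"
    using assms by (rule good_pairE)
  then interpret good_pair X A B H .
  show ?thesis
    using exact_at_X exact_at_quotient exact_at_A by (intro exI[of _ connecting]) blast
qed

end
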